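(* Let $\mathcal{A}$ be a category with binary products and a strict initial object. Let $\mathcal{F} \colon \mathcal{A}^{\mathrm{op}} \to \mathsf{CAT}$ be the pseudofunctor sending an object $a$ to the co-Kleisli category $\mathsf{CoKl}(a \times -)$ of the comonad $a \times -$ on $\mathcal{A}$, and a morphism $f \colon a \to b$ to the functor $\mathcal{F}_f \colon \mathsf{CoKl}(b\times -) \to \mathsf{CoKl}(a \times -)$ that is the identity on objects and sends $p \in \mathcal{A}(b\times x, y)$ to $p \circ (f \times \mathrm{id}_x) \in \mathcal{A}(a \times x, y)$. Then the Grothendieck construction $U \colon \int_{\mathcal{A}} \mathcal{F} \to \mathcal{A}$ of $\mathcal{F}$ preserves effective descent morphisms.
   Context: The co-Kleisli category $\mathsf{CoKl}(a \times -)$ has the same objects as $\mathcal{A}$; $\mathsf{CoKl}(a\times -)(x,y) = \mathcal{A}(a \times x, y)$; identities are the product projections $a \times x \to x$; and the composite of $f \colon a\times x \to y$ and $g \colon a \times y \to z$ is $g \circ (\mathrm{id}_a \times f)\circ(\Delta \times \mathrm{id}_x)$, with $\Delta \colon a \to a \times a$ the diagonal. $\mathsf{CAT}$ is the 2-category of (possibly large) categories. The Grothendieck construction of a pseudofunctor $\mathcal{F} \colon \mathcal{A}^{\mathrm{op}} \to \mathsf{CAT}$ is the projection $\int_{\mathcal{A}} \mathcal{F} \to \mathcal{A}$, $(a,x)\mapsto a$, where $\int_{\mathcal{A}} \mathcal{F}$ has as objects the pairs $(a,x)$ with $a \in \mathcal{A}$ and $x \in \mathcal{F}_a$, and as morphisms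 $(a,x)\to(b,y)$ the pairs $(f,\phi)$ with $f \colon a \to b$ in $\mathcal{A}$ and $\phi \colon x \to \mathcal{F}_f(y)$ in $\mathcal{F}_a$, with the usual composition. An initial object $\mathsf{0}$ of a category is strict if every object $x$ admitting a morphism $x \to \mathsf{0}$ is isomorphic to $\mathsf{0}$. A morphism $p \colon a \to b$ in a category $\mathcal{X}$ is an effective descent morphism if all pullbacks along $p$ exist in $\mathcal{X}$ (equivalently, the functor $p_! \colon \mathcal{X} \downarrow a \to \mathcal{X} \downarrow b$, $f \mapsto p \circ f$, between slice categories has a right adjoint $p^*$) and $p^*$ is monadic (its comparison functor into the Eilenberg-Moore category of the monad induced by $p_! \dashv p^*$ is an equivalence). No existence of other pullbacks in $\mathcal{X}$ is assumed. A functor $F$ preserves effective descent morphisms if $F(p)$ is an effective descent morphism whenever $p$ is. *)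

theory Defs
  imports Main
begin

section \<open>Categories, functors, natural transformations\<close>

text \<open>Hom-sets are not required to be disjoint, so composition takes the three objects as
  arguments, and \<open>Cmp C x y z g f\<close> is the composite of \<open>f : x \<rightarrow> y\<close> followed by
  \<open>g : y \<rightarrow> z\<close>. For the same reason the action of a functor on arrows takes the
  source and target objects.\<close>

record ('o, 'm) cat =
  Obj :: "'o set"
  Hom :: "'o \<Rightarrow> 'o \<Rightarrow> 'm set"
  Ide :: "'o \<Rightarrow> 'm"
  Cmp :: "'o \<Rightarrow> 'o \<Rightarrow> 'o \<Rightarrow> 'm \<Rightarrow> 'm \<Rightarrow> 'm"

locale category =
  fixes C :: "('o, 'm) cat"
  assumes ide_in: "x \<in> Obj C \<Longrightarrow> Ide C x \<in> Hom C x x"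
    and cmp_in: "\<lbrakk>x \<in> Obj C; y \<in> Obj C; z \<in> Obj C; f \<in> Hom C x y; g \<in> Hom C y z\<rbrakk>
      \<Longrightarrow> Cmp C x y z g f \<in> Hom C x z"
    and cmp_ide_left: "\<lbrakk>x \<in> Obj C; y \<in> Obj C; f \<in> Hom C x y\<rbrakk>
      \<Longrightarrow> Cmp C x y y (Ide C y) f = f"
    and cmp_ide_right: "\<lbrakk>x \<in> Obj C; y \<in> Obj C; f \<in> Hom C x y\<rbrakk>
      \<Longrightarrow> Cmp C x x y f (Ide C x) = f"
    and cmp_assoc: "\<lbrakk>w \<in> Obj C; x \<in> Obj C; y \<in> Obj C; z \<in> Obj C;
        f \<in> Hom C w x; g \<in> Hom C x y; h \<in> Hom C y z\<rbrakk>
      \<Longrightarrow> Cmp C w y z h (Cmp C w x y g f) = Cmp C w x z (Cmp C x y z h g) f"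

definition is_iso :: "('o, 'm) cat \<Rightarrow> 'o \<Rightarrow> 'o \<Rightarrow> 'm \<Rightarrow> bool" where
  "is_iso C x y f \<longleftrightarrow> f \<in> Hom C x y \<and>
     (\<exists>g \<in> Hom C y x. Cmp C x y x g f = Ide C x \<and> Cmp C y x y f g = Ide C y)"

definition isomorphic :: "('o, 'm) cat \<Rightarrow> 'o \<Rightarrow> 'o \<Rightarrow> bool" where
  "isomorphic C x y \<longleftrightarrow> (\<exists>f. is_iso C x y f)"

record ('o, 'm, 'p, 'n) fctr =
  FO :: "'o \<Rightarrow> 'p"
  FM :: "'o \<Rightarrow> 'o \<Rightarrow> 'm \<Rightarrow> 'n"

definition is_functor :: "('o, 'm) cat \<Rightarrow> ('p, 'n) cat \<Rightarrow> ('o, 'm, 'p, 'n) fctr \<Rightarrow> bool" where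
  "is_functor C D F \<longleftrightarrow>
     (\<forall>x \<in> Obj C. FO F x \<in> Obj D) \<and>
     (\<forall>x \<in> Obj C. \<forall>y \<in> Obj C. \<forall>f \<in> Hom C x y. FM F x y f \<in> Hom D (FO F x) (FO F y)) \<and>
     (\<forall>x \<in> Obj C. FM F x x (Ide C x) = Ide D (FO F x)) \<and>
     (\<forall>x \<in> Obj C. \<forall>y \<in> Obj C. \<forall>z \<in> Obj C. \<forall>f \<in> Hom C x y. \<forall>g \<in> Hom C y z.
        FM F x z (Cmp C x y z g f) =
          Cmp D (FO F x) (FO F y) (FO F z) (FM F y z g) (FM F x y f))"

definition fident :: "('o, 'm, 'o, 'm) fctr" where
  "fident = \<lparr>FO = (\<lambda>x. x), FM = (\<lambda>x y f. f)\<rparr>"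

definition fcompose ::
  "('p, 'n, 'q, 'k) fctr \<Rightarrow> ('o, 'm, 'p, 'n) fctr \<Rightarrow> ('o, 'm, 'q, 'k) fctr" where
  "fcompose G F = \<lparr>FO = (\<lambda>x. FO G (FO F x)),
                   FM = (\<lambda>x y f. FM G (FO F x) (FO F y) (FM F x y f))\<rparr>"

definition nat_trans :: "('o, 'm) cat \<Rightarrow> ('p, 'n) cat \<Rightarrow> ('o, 'm, 'p, 'n) fctr \<Rightarrow>
    ('o, 'm, 'p, 'n) fctr \<Rightarrow> ('o \<Rightarrow> 'n) \<Rightarrow> bool" where
  "nat_trans C D F G t \<longleftrightarrow>
     (\<forall>x \<in> Obj C. t x \<in> Hom D (FO F x) (FO G x)) \<and>
     (\<forall>x \<in> Obj C. \<forall>y \<in> Obj C. \<forall>f \<in> Hom C x y.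
        Cmp D (FO F x) (FO F y) (FO G y) (t y) (FM F x y f) =
        Cmp D (FO F x) (FO G x) (FO G y) (FM G x y f) (t x))"

definition nat_iso :: "('o, 'm) cat \<Rightarrow> ('p, 'n) cat \<Rightarrow> ('o, 'm, 'p, 'n) fctr \<Rightarrow>
    ('o, 'm, 'p, 'n) fctr \<Rightarrow> ('o \<Rightarrow> 'n) \<Rightarrow> bool" where
  "nat_iso C D F G t \<longleftrightarrow> nat_trans C D F G t \<and>
     (\<forall>x \<in> Obj C. is_iso D (FO F x) (FO G x) (t x))"

definition is_equivalence :: "('o, 'm) cat \<Rightarrow> ('p, 'n) cat \<Rightarrow> ('o, 'm, 'p, 'n) fctr \<Rightarrow> bool"
  where
  "is_equivalence C D F \<longleftrightarrow> is_functor C D F \<and>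
     (\<exists>G s t. is_functor D C G \<and>
        nat_iso C C fident (fcompose G F) s \<and> nat_iso D D (fcompose F G) fident t)"


section \<open>Adjunctions, monads, Eilenberg--Moore categories\<close>

definition adjunction :: "('o, 'm) cat \<Rightarrow> ('p, 'n) cat \<Rightarrow> ('o, 'm, 'p, 'n) fctr \<Rightarrow>
    ('p, 'n, 'o, 'm) fctr \<Rightarrow> ('o \<Rightarrow> 'm) \<Rightarrow> ('p \<Rightarrow> 'n) \<Rightarrow> bool" where
  "adjunction C D L R \<eta> \<epsilon> \<longleftrightarrow>
     is_functor C D L \<and> is_functor D C R \<and>
     nat_trans C C fident (fcompose R L) \<eta> \<and>
     nat_trans D D (fcompose L R) fident \<epsilon> \<and>
     (\<forall>x \<in> Obj C.
        Cmp D (FO L x) (FO L (FO R (FO L x))) (FO L x)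
          (\<epsilon> (FO L x)) (FM L x (FO R (FO L x)) (\<eta> x)) = Ide D (FO L x)) \<and>
     (\<forall>y \<in> Obj D.
        Cmp C (FO R y) (FO R (FO L (FO R y))) (FO R y)
          (FM R (FO L (FO R y)) y (\<epsilon> y)) (\<eta> (FO R y)) = Ide C (FO R y))"

record ('o, 'm) mnd =
  Fct :: "('o, 'm, 'o, 'm) fctr"
  Unit :: "'o \<Rightarrow> 'm"
  Mult :: "'o \<Rightarrow> 'm"

definition induced_monad :: "('o, 'm, 'p, 'n) fctr \<Rightarrow> ('p, 'n, 'o, 'm) fctr \<Rightarrow>
    ('o \<Rightarrow> 'm) \<Rightarrow> ('p \<Rightarrow> 'n) \<Rightarrow> ('o, 'm) mnd" where
  "induced_monad L R \<eta> \<epsilon> =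
     \<lparr>Fct = fcompose R L, Unit = \<eta>,
      Mult = (\<lambda>x. FM R (FO L (FO R (FO L x))) (FO L x) (\<epsilon> (FO L x)))\<rparr>"

definition eilenberg_moore :: "('o, 'm) cat \<Rightarrow> ('o, 'm) mnd \<Rightarrow> ('o \<times> 'm, 'm) cat" where
  "eilenberg_moore C M = (let T = FO (Fct M); Tm = FM (Fct M) in
     \<lparr>Obj = {(x, h). x \<in> Obj C \<and> h \<in> Hom C (T x) x \<and>
               Cmp C x (T x) x h (Unit M x) = Ide C x \<and>
               Cmp C (T (T x)) (T x) x h (Mult M x) =
               Cmp C (T (T x)) (T x) x h (Tm (T x) x h)},
      Hom = (\<lambda>(x, h) (y, k). {f \<in> Hom C x y.
               Cmp C (T x) x y f h = Cmp C (T x) (T y) y k (Tm x y f)}),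
      Ide = (\<lambda>(x, h). Ide C x),
      Cmp = (\<lambda>(x, h) (y, k) (z, l) g f. Cmp C x y z g f)\<rparr>)"

definition comparison :: "('o, 'm, 'p, 'n) fctr \<Rightarrow> ('p, 'n, 'o, 'm) fctr \<Rightarrow>
    ('p \<Rightarrow> 'n) \<Rightarrow> ('p, 'n, 'o \<times> 'm, 'm) fctr" where
  "comparison L R \<epsilon> =
     \<lparr>FO = (\<lambda>y. (FO R y, FM R (FO L (FO R y)) y (\<epsilon> y))), FM = FM R\<rparr>"

definition monadic :: "('o, 'm) cat \<Rightarrow> ('p, 'n) cat \<Rightarrow> ('o, 'm, 'p, 'n) fctr \<Rightarrow>
    ('p, 'n, 'o, 'm) fctr \<Rightarrow> ('o \<Rightarrow> 'm) \<Rightarrow> ('p \<Rightarrow> 'n) \<Rightarrow> bool" where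
  "monadic C D L R \<eta> \<epsilon> \<longleftrightarrow> adjunction C D L R \<eta> \<epsilon> \<and>
     is_equivalence D (eilenberg_moore C (induced_monad L R \<eta> \<epsilon>)) (comparison L R \<epsilon>)"


section \<open>Effective descent morphisms\<close>

definition slice :: "('o, 'm) cat \<Rightarrow> 'o \<Rightarrow> ('o \<times> 'm, 'm) cat" where
  "slice C a =
     \<lparr>Obj = {(x, f). x \<in> Obj C \<and> f \<in> Hom C x a},
      Hom = (\<lambda>(x, f) (y, g). {h \<in> Hom C x y. Cmp C x y a g h = f}),
      Ide = (\<lambda>(x, f). Ide C x),
      Cmp = (\<lambda>(x, f) (y, g) (z, h) k l. Cmp C x y z k l)\<rparr>"

definition slice_push :: "('o, 'm) cat \<Rightarrow> 'o \<Rightarrow> 'o \<Rightarrow> 'm \<Rightarrow> ('o \<times> 'm, 'm, 'o \<times> 'm, 'm) fctr"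
  where
  "slice_push C a b p =
     \<lparr>FO = (\<lambda>(x, f). (x, Cmp C x a b p f)), FM = (\<lambda>_ _ h. h)\<rparr>"

text \<open>\<open>u : d \<rightarrow> a\<close> and \<open>v : d \<rightarrow> c\<close> form a pullback of the cospan
  \<open>p : a \<rightarrow> b\<close>, \<open>g : c \<rightarrow> b\<close>.\<close>

definition is_pullback :: "('o, 'm) cat \<Rightarrow> 'o \<Rightarrow> 'o \<Rightarrow> 'o \<Rightarrow> 'm \<Rightarrow> 'm \<Rightarrow> 'o \<Rightarrow> 'm \<Rightarrow> 'm \<Rightarrow> bool"
  where
  "is_pullback C a b c p g d u v \<longleftrightarrow>
     d \<in> Obj C \<and> u \<in> Hom C d a \<and> v \<in> Hom C d c \<and> Cmp C d a b p u = Cmp C d c b g v \<and>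
     (\<forall>e \<in> Obj C. \<forall>r \<in> Hom C e a. \<forall>s \<in> Hom C e c. Cmp C e a b p r = Cmp C e c b g s \<longrightarrow>
        (\<exists>!t. t \<in> Hom C e d \<and> Cmp C e d a u t = r \<and> Cmp C e d c v t = s))"

definition has_pullbacks_along :: "('o, 'm) cat \<Rightarrow> 'o \<Rightarrow> 'o \<Rightarrow> 'm \<Rightarrow> bool" where
  "has_pullbacks_along C a b p \<longleftrightarrow>
     (\<forall>c \<in> Obj C. \<forall>g \<in> Hom C c b. \<exists>d u v. is_pullback C a b c p g d u v)"

text \<open>The right adjoint \<open>R\<close> below is the pullback functor along \<open>p\<close>, which is only
  determined up to isomorphism.\<close>

definition effective_descent :: "('o, 'm) cat \<Rightarrow> 'o \<Rightarrow> 'o \<Rightarrow> 'm \<Rightarrow> bool" where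
  "effective_descent C a b p \<longleftrightarrow>
     a \<in> Obj C \<and> b \<in> Obj C \<and> p \<in> Hom C a b \<and> has_pullbacks_along C a b p \<and>
     (\<exists>R \<eta> \<epsilon>. monadic (slice C a) (slice C b) (slice_push C a b p) R \<eta> \<epsilon>)"

definition preserves_effective_descent ::
  "('o, 'm) cat \<Rightarrow> ('p, 'n) cat \<Rightarrow> ('o, 'm, 'p, 'n) fctr \<Rightarrow> bool" where
  "preserves_effective_descent C D F \<longleftrightarrow>
     (\<forall>a b p. effective_descent C a b p \<longrightarrow>
        effective_descent D (FO F a) (FO F b) (FM F a b p))"


section \<open>Products and initial objects\<close>

definition is_product :: "('o, 'm) cat \<Rightarrow> 'o \<Rightarrow> 'o \<Rightarrow> 'o \<Rightarrow> 'm \<Rightarrow> 'm \<Rightarrow> bool" where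
  "is_product C a b d u v \<longleftrightarrow>
     d \<in> Obj C \<and> u \<in> Hom C d a \<and> v \<in> Hom C d b \<and>
     (\<forall>e \<in> Obj C. \<forall>r \<in> Hom C e a. \<forall>s \<in> Hom C e b.
        \<exists>!t. t \<in> Hom C e d \<and> Cmp C e d a u t = r \<and> Cmp C e d b v t = s)"

text \<open>A choice of a product object and projections for each pair of objects.\<close>

record ('o, 'm) prods =
  Prd :: "'o \<Rightarrow> 'o \<Rightarrow> 'o"
  Fst :: "'o \<Rightarrow> 'o \<Rightarrow> 'm"
  Snd :: "'o \<Rightarrow> 'o \<Rightarrow> 'm"

definition binary_products :: "('o, 'm) cat \<Rightarrow> ('o, 'm) prods \<Rightarrow> bool" where
  "binary_products C P \<longleftrightarrow> (\<forall>a \<in> Obj C. \<forall>b \<in> Obj C.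
     is_product C a b (Prd P a b) (Fst P a b) (Snd P a b))"

definition pairing ::
  "('o, 'm) cat \<Rightarrow> ('o, 'm) prods \<Rightarrow> 'o \<Rightarrow> 'o \<Rightarrow> 'o \<Rightarrow> 'm \<Rightarrow> 'm \<Rightarrow> 'm" where
  "pairing C P e a b r s = (THE t. t \<in> Hom C e (Prd P a b) \<and>
     Cmp C e (Prd P a b) a (Fst P a b) t = r \<and> Cmp C e (Prd P a b) b (Snd P a b) t = s)"

text \<open>\<open>f \<times> g : a \<times> b \<rightarrow> c \<times> d\<close> for \<open>f : a \<rightarrow> c\<close>, \<open>g : b \<rightarrow> d\<close>\<close>

definition prod_map ::
  "('o, 'm) cat \<Rightarrow> ('o, 'm) prods \<Rightarrow> 'o \<Rightarrow> 'o \<Rightarrow> 'o \<Rightarrow> 'o \<Rightarrow> 'm \<Rightarrow> 'm \<Rightarrow> 'm" where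
  "prod_map C P a b c d f g =
     pairing C P (Prd P a b) c d
       (Cmp C (Prd P a b) a c f (Fst P a b)) (Cmp C (Prd P a b) b d g (Snd P a b))"

definition diagonal :: "('o, 'm) cat \<Rightarrow> ('o, 'm) prods \<Rightarrow> 'o \<Rightarrow> 'm" where
  "diagonal C P a = pairing C P a a a (Ide C a) (Ide C a)"

text \<open>\<open>(a \<times> b) \<times> c \<rightarrow> a \<times> (b \<times> c)\<close>\<close>

definition associator :: "('o, 'm) cat \<Rightarrow> ('o, 'm) prods \<Rightarrow> 'o \<Rightarrow> 'o \<Rightarrow> 'o \<Rightarrow> 'm" where
  "associator C P a b c = (let ab = Prd P a b; abc = Prd P ab c in
     pairing C P abc a (Prd P b c)
       (Cmp C abc ab a (Fst P a b) (Fst P ab c))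
       (pairing C P abc b c (Cmp C abc ab b (Snd P a b) (Fst P ab c)) (Snd P ab c)))"

definition is_initial :: "('o, 'm) cat \<Rightarrow> 'o \<Rightarrow> bool" where
  "is_initial C z \<longleftrightarrow> z \<in> Obj C \<and> (\<forall>x \<in> Obj C. \<exists>!f. f \<in> Hom C z x)"

definition is_strict_initial :: "('o, 'm) cat \<Rightarrow> 'o \<Rightarrow> bool" where
  "is_strict_initial C z \<longleftrightarrow> is_initial C z \<and>
     (\<forall>x \<in> Obj C. Hom C x z \<noteq> {} \<longrightarrow> isomorphic C x z)"


section \<open>Pseudofunctors and the Grothendieck construction\<close>

text \<open>The data of a pseudofunctor from the opposite of a category to CAT, with values written
  \<open>F\<^sub>a\<close> and \<open>F\<^sub>f : F\<^sub>b \<rightarrow> F\<^sub>a\<close> for \<open>f : a \<rightarrow> b\<close>.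
  The comparison cells are \<open>Coh_id a x : x \<rightarrow> F\<^sub>i\<^sub>d x\<close> and
  \<open>Coh_cmp a b c f g z : F\<^sub>f (F\<^sub>g z) \<rightarrow> F\<^sub>g\<^sub>f z\<close> for \<open>f : a \<rightarrow> b\<close>, \<open>g : b \<rightarrow> c\<close>.\<close>

record ('o, 'm, 'x, 'n) psf =
  Fib :: "'o \<Rightarrow> ('x, 'n) cat"
  Sub :: "'o \<Rightarrow> 'o \<Rightarrow> 'm \<Rightarrow> ('x, 'n, 'x, 'n) fctr"
  Coh_id :: "'o \<Rightarrow> 'x \<Rightarrow> 'n"
  Coh_cmp :: "'o \<Rightarrow> 'o \<Rightarrow> 'o \<Rightarrow> 'm \<Rightarrow> 'm \<Rightarrow> 'x \<Rightarrow> 'n"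

definition is_pseudofunctor :: "('o, 'm) cat \<Rightarrow> ('o, 'm, 'x, 'n) psf \<Rightarrow> bool" where
  "is_pseudofunctor A F \<longleftrightarrow>
     (\<forall>a \<in> Obj A. category (Fib F a)) \<and>
     (\<forall>a \<in> Obj A. \<forall>b \<in> Obj A. \<forall>f \<in> Hom A a b. is_functor (Fib F b) (Fib F a) (Sub F a b f)) \<and>
     (\<forall>a \<in> Obj A. nat_iso (Fib F a) (Fib F a) fident (Sub F a a (Ide A a)) (Coh_id F a)) \<and>
     (\<forall>a \<in> Obj A. \<forall>b \<in> Obj A. \<forall>c \<in> Obj A. \<forall>f \<in> Hom A a b. \<forall>g \<in> Hom A b c.
        nat_iso (Fib F c) (Fib F a) (fcompose (Sub F a b f) (Sub F b c g))
          (Sub F a c (Cmp A a b c g f)) (Coh_cmp F a b c f g)) \<and>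
     (\<forall>a \<in> Obj A. \<forall>b \<in> Obj A. \<forall>f \<in> Hom A a b. \<forall>y \<in> Obj (Fib F b).
        let fy = FO (Sub F a b f) y in
        Cmp (Fib F a) fy (FO (Sub F a a (Ide A a)) fy) fy
          (Coh_cmp F a a b (Ide A a) f y) (Coh_id F a fy) = Ide (Fib F a) fy \<and>
        Cmp (Fib F a) fy (FO (Sub F a b f) (FO (Sub F b b (Ide A b)) y)) fy
          (Coh_cmp F a b b f (Ide A b) y)
          (FM (Sub F a b f) y (FO (Sub F b b (Ide A b)) y) (Coh_id F b y)) = Ide (Fib F a) fy) \<and>
     (\<forall>a \<in> Obj A. \<forall>b \<in> Obj A. \<forall>c \<in> Obj A. \<forall>d \<in> Obj A.
      \<forall>f \<in> Hom A a b. \<forall>g \<in> Hom A b c. \<forall>h \<in> Hom A c d. \<forall>w \<in> Obj (Fib F d).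
        let hw = FO (Sub F c d h) w;
            ghw = FO (Sub F b c g) hw;
            gf = Cmp A a b c g f;
            hg = Cmp A b c d h g;
            hgw = FO (Sub F b d hg) w;
            hgfw = FO (Sub F a d (Cmp A a b d hg f)) w
        in
        Cmp (Fib F a) (FO (Sub F a b f) ghw) (FO (Sub F a b f) hgw) hgfw
          (Coh_cmp F a b d f hg w) (FM (Sub F a b f) ghw hgw (Coh_cmp F b c d g h w)) =
        Cmp (Fib F a) (FO (Sub F a b f) ghw) (FO (Sub F a c gf) hw) hgfw
          (Coh_cmp F a c d gf h w) (Coh_cmp F a b c f g hw))"

definition grothendieck ::
  "('o, 'm) cat \<Rightarrow> ('o, 'm, 'x, 'n) psf \<Rightarrow> ('o \<times> 'x, 'm \<times> 'n) cat" where
  "grothendieck A F =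
     \<lparr>Obj = {(a, x). a \<in> Obj A \<and> x \<in> Obj (Fib F a)},
      Hom = (\<lambda>(a, x) (b, y).
        {(f, \<phi>). f \<in> Hom A a b \<and> \<phi> \<in> Hom (Fib F a) x (FO (Sub F a b f) y)}),
      Ide = (\<lambda>(a, x). (Ide A a, Coh_id F a x)),
      Cmp = (\<lambda>(a, x) (b, y) (c, z) (g, \<gamma>) (f, \<phi>).
        let gf = Cmp A a b c g f;
            fy = FO (Sub F a b f) y;
            gz = FO (Sub F b c g) z;
            fgz = FO (Sub F a b f) gz
        in (gf, Cmp (Fib F a) x fgz (FO (Sub F a c gf) z)
                  (Coh_cmp F a b c f g z)
                  (Cmp (Fib F a) x fy fgz (FM (Sub F a b f) y gz \<gamma>) \<phi>)))\<rparr>"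

definition grothendieck_proj :: "('o \<times> 'x, 'm \<times> 'n, 'o, 'm) fctr" where
  "grothendieck_proj = \<lparr>FO = fst, FM = (\<lambda>_ _. fst)\<rparr>"


section \<open>The co-Kleisli pseudofunctor\<close>

text \<open>The composite of \<open>f : a \<times> x \<rightarrow> y\<close> and \<open>g : a \<times> y \<rightarrow> z\<close> is
  \<open>a \<times> x \<rightarrow> (a \<times> a) \<times> x \<rightarrow> a \<times> (a \<times> x) \<rightarrow> a \<times> y \<rightarrow> z\<close>; the
  associator is usually suppressed in print.\<close>

definition cokleisli :: "('o, 'm) cat \<Rightarrow> ('o, 'm) prods \<Rightarrow> 'o \<Rightarrow> ('o, 'm) cat" where
  "cokleisli A P a =
     \<lparr>Obj = Obj A,
      Hom = (\<lambda>x y. Hom A (Prd P a x) y),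
      Ide = (\<lambda>x. Snd P a x),
      Cmp = (\<lambda>x y z g f.
        let ax = Prd P a x; aax = Prd P (Prd P a a) x; a_ax = Prd P a ax; ay = Prd P a y in
        Cmp A ax ay z g
          (Cmp A ax a_ax ay (prod_map A P a ax a y (Ide A a) f)
             (Cmp A ax aax a_ax (associator A P a a x)
                (prod_map A P a x (Prd P a a) x (diagonal A P a) (Ide A x)))))\<rparr>"

definition cokleisli_sub ::
  "('o, 'm) cat \<Rightarrow> ('o, 'm) prods \<Rightarrow> 'o \<Rightarrow> 'o \<Rightarrow> 'm \<Rightarrow> ('o, 'm, 'o, 'm) fctr" where
  "cokleisli_sub A P a b f =
     \<lparr>FO = (\<lambda>x. x),
      FM = (\<lambda>x y p. Cmp A (Prd P a x) (Prd P b x) y p (prod_map A P a x b x f (Ide A x)))\<rparr>"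

text \<open>This pseudofunctor is strict: all comparison cells are identities.\<close>

definition cokleisli_psf :: "('o, 'm) cat \<Rightarrow> ('o, 'm) prods \<Rightarrow> ('o, 'm, 'o, 'm) psf" where
  "cokleisli_psf A P =
     \<lparr>Fib = cokleisli A P,
      Sub = cokleisli_sub A P,
      Coh_id = (\<lambda>a x. Ide (cokleisli A P a) x),
      Coh_cmp = (\<lambda>a b c f g z. Ide (cokleisli A P a) z)\<rparr>"

text \<open>The data in \<open>cokleisli_psf\<close> do satisfy the laws of a pseudofunctor. In
  particular the composition of \<open>cokleisli\<close> simplifies to \<open>g \<circ> \<langle>\<pi>\<^sub>1, f\<rangle>\<close>.\<close>

locale category_with_products = category A for A :: "('o, 'm) cat" +
  fixes P :: "('o, 'm) prods"
  assumes binary_products: "binary_products A P"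
begin

lemma
  assumes "a \<in> Obj A" "b \<in> Obj A"
  shows prd_obj: "Prd P a b \<in> Obj A"
    and fst_in: "Fst P a b \<in> Hom A (Prd P a b) a"
    and snd_in: "Snd P a b \<in> Hom A (Prd P a b) b"
  using binary_products assms unfolding binary_products_def is_product_def by blast+

lemma pairing_ex1:
  assumes "a \<in> Obj A" "b \<in> Obj A" "e \<in> Obj A" "r \<in> Hom A e a" "s \<in> Hom A e b"
  shows "\<exists>!t. t \<in> Hom A e (Prd P a b) \<and>
    Cmp A e (Prd P a b) a (Fst P a b) t = r \<and> Cmp A e (Prd P a b) b (Snd P a b) t = s"
  using binary_products assms unfolding binary_products_def is_product_def by blast

lemma
  assumes "a \<in> Obj A" "b \<in> Obj A" "e \<in> Obj A" "r \<in> Hom A e a" "s \<in> Hom A e b"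
  shows pairing_in: "pairing A P e a b r s \<in> Hom A e (Prd P a b)"
    and fst_pairing: "Cmp A e (Prd P a b) a (Fst P a b) (pairing A P e a b r s) = r"
    and snd_pairing: "Cmp A e (Prd P a b) b (Snd P a b) (pairing A P e a b r s) = s"
  using theI'[OF pairing_ex1[OF assms]] unfolding pairing_def by auto

lemma pairing_eqI:
  assumes "a \<in> Obj A" "b \<in> Obj A" "e \<in> Obj A"
    and "t \<in> Hom A e (Prd P a b)" "u \<in> Hom A e (Prd P a b)"
    and "Cmp A e (Prd P a b) a (Fst P a b) t = Cmp A e (Prd P a b) a (Fst P a b) u"
    and "Cmp A e (Prd P a b) b (Snd P a b) t = Cmp A e (Prd P a b) b (Snd P a b) u"
  shows "t = u"
proof -
  have "Cmp A e (Prd P a b) a (Fst P a b) u \<in> Hom A e a"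
    "Cmp A e (Prd P a b) b (Snd P a b) u \<in> Hom A e b"
    using assms by (auto intro!: cmp_in prd_obj fst_in snd_in)
  from pairing_ex1[OF assms(1-3) this] show ?thesis using assms by blast
qed

lemmas prod_simps = prd_obj fst_in snd_in pairing_in fst_pairing snd_pairing
  ide_in cmp_in cmp_ide_left cmp_ide_right

lemma pairing_cmp:
  assumes "a \<in> Obj A" "b \<in> Obj A" "e \<in> Obj A" "d \<in> Obj A"
    and "r \<in> Hom A e a" "s \<in> Hom A e b" "h \<in> Hom A d e"
  shows "Cmp A d e (Prd P a b) (pairing A P e a b r s) h =
    pairing A P d a b (Cmp A d e a r h) (Cmp A d e b s h)"
  by (rule pairing_eqI[of a b d]) (use assms in \<open>simp_all add: prod_simps cmp_assoc\<close>)

lemma pairing_eta: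
  assumes "a \<in> Obj A" "b \<in> Obj A"
  shows "pairing A P (Prd P a b) a b (Fst P a b) (Snd P a b) = Ide A (Prd P a b)"
  by (rule pairing_eqI[of a b "Prd P a b"]) (use assms in \<open>simp_all add: prod_simps\<close>)

lemmas prod_norm = prod_simps cmp_assoc[symmetric] pairing_cmp pairing_eta
  prod_map_def associator_def diagonal_def Let_def

lemma cokleisli_cmp:
  assumes "a \<in> Obj A" "x \<in> Obj A" "y \<in> Obj A" "z \<in> Obj A"
    and "f \<in> Hom A (Prd P a x) y" "g \<in> Hom A (Prd P a y) z"
  shows "Cmp (cokleisli A P a) x y z g f =
    Cmp A (Prd P a x) (Prd P a y) z g (pairing A P (Prd P a x) a y (Fst P a x) f)"
  using assms by (simp add: cokleisli_def prod_norm)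

lemma cokleisli_simps:
  "Obj (cokleisli A P a) = Obj A"
  "Hom (cokleisli A P a) x y = Hom A (Prd P a x) y"
  "Ide (cokleisli A P a) x = Snd P a x"
  by (simp_all add: cokleisli_def)

lemma cokleisli_category: "a \<in> Obj A \<Longrightarrow> category (cokleisli A P a)"
  by unfold_locales (simp_all add: cokleisli_simps cokleisli_cmp prod_norm)

lemma cokleisli_pseudofunctor: "is_pseudofunctor A (cokleisli_psf A P)"
  unfolding is_pseudofunctor_def cokleisli_psf_def is_functor_def nat_iso_def nat_trans_def
    is_iso_def
  by (intro conjI ballI) (simp_all add: cokleisli_simps cokleisli_category cokleisli_cmp
    prod_norm cokleisli_sub_def fident_def fcompose_def)

end

end

theory Submission
  imports Defs
begin

text \<open>Call an object \<open>d\<close> of the Grothendieck construction \<open>E\<close> discrete if every arrow \<open>U d \<rightarrow> U r\<close> of \<open>A\<close> lifts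
uniquely to an arrow \<open>d \<rightarrow> r\<close>. An arrow \<open>(a, x) \<rightarrow> (b, y)\<close> is a pair of an arrow \<open>a \<rightarrow> b\<close> and an arrow
\<open>a \<times> x \<rightarrow> y\<close>, so \<open>(a, x)\<close> is discrete exactly if \<open>a \<times> x\<close> is initial. Strictness of the initial object \<open>z\<close> enters
twice: \<open>(a, z)\<close> is a discrete object over \<open>a\<close>, and an object with an arrow to a discrete object is itself discrete
(\<open>simple_fibration_enough_discrete\<close>).

Every functor \<open>U : E \<rightarrow> A\<close> with these two properties preserves effective descent morphisms. Let \<open>p : a \<rightarrow> b\<close>
be one in \<open>E\<close>. Cospans and cones in \<open>A\<close> lift to discrete objects, which yields pullbacks along \<open>U p\<close>. For descent, an
arrow \<open>c \<rightarrow> U b\<close> is lifted to an arrow into \<open>b\<close> with discrete domain. Since discrete objects form a sieve, the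
pullback of this arrow along \<open>p\<close> and everything that takes part in descent data on it are again discrete, so that the
calculation in \<open>E\<close> is the calculation in \<open>A\<close>. In particular, a descent datum in \<open>A\<close> lifts to a descent datum in \<open>E\<close>;
this is realized by an object over \<open>b\<close>, whose image under \<open>U\<close> realizes the original datum.

The right adjoints for \<open>p\<close> and for \<open>U p\<close>, hence their monads and algebras, correspond only up to isomorphism,
whereas \<open>U\<close> commutes strictly with composition by \<open>p\<close>. For this reason \<open>monadic_iff_descends\<close> first replaces
the existence of a monadic right adjoint of \<open>L\<close> by a condition on \<open>L\<close> alone: each object \<open>y\<close> has a universal arrow
\<open>e : L r \<rightarrow> y\<close> which is a suitable coequalizer, and every operation \<open>\<theta>\<close> from arrows \<open>L w \<rightarrow> L x\<close> to arrows \<open>w \<rightarrow> x\<close>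
obeying the laws of an algebra is realized by a universal arrow out of \<open>L x\<close>. This condition is transferred from \<open>E\<close> to
\<open>A\<close> in \<open>descends_image\<close>.\<close>

section \<open>Equivalences as fully faithful, essentially surjective functors\<close>

lemma functorD:
  assumes "is_functor C D F"
  shows functor_obj: "x \<in> Obj C \<Longrightarrow> FO F x \<in> Obj D"
    and functor_hom: "\<lbrakk>x \<in> Obj C; y \<in> Obj C; f \<in> Hom C x y\<rbrakk> \<Longrightarrow> FM F x y f \<in> Hom D (FO F x) (FO F y)"
    and functor_ide: "x \<in> Obj C \<Longrightarrow> FM F x x (Ide C x) = Ide D (FO F x)"
    and functor_cmp: "\<lbrakk>x \<in> Obj C; y \<in> Obj C; w \<in> Obj C; f \<in> Hom C x y; g \<in> Hom C y w\<rbrakk> \<Longrightarrow>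
      FM F x w (Cmp C x y w g f) = Cmp D (FO F x) (FO F y) (FO F w) (FM F y w g) (FM F x y f)"
  using assms unfolding is_functor_def by blast+

lemma is_isoI:
  assumes "f \<in> Hom C x y" "g \<in> Hom C y x" "Cmp C x y x g f = Ide C x" "Cmp C y x y f g = Ide C y"
  shows "is_iso C x y f"
  using assms unfolding is_iso_def by blast

definition fully_faithful :: "('o, 'm) cat \<Rightarrow> ('p, 'n) cat \<Rightarrow> ('o, 'm, 'p, 'n) fctr \<Rightarrow> bool" where
  "fully_faithful C D F \<longleftrightarrow> (\<forall>x \<in> Obj C. \<forall>y \<in> Obj C. \<forall>g \<in> Hom D (FO F x) (FO F y).
     \<exists>!f. f \<in> Hom C x y \<and> FM F x y f = g)"

definition essentially_surjective ::
  "('o, 'm) cat \<Rightarrow> ('p, 'n) cat \<Rightarrow> ('o, 'm, 'p, 'n) fctr \<Rightarrow> bool" where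
  "essentially_surjective C D F \<longleftrightarrow> (\<forall>d \<in> Obj D. \<exists>c \<in> Obj C. isomorphic D (FO F c) d)"

context category
begin

lemma iso_cancel_left:
  assumes "is_iso C y w i" "Cmp C x y w i f = Cmp C x y w i g"
    and "x \<in> Obj C" "y \<in> Obj C" "w \<in> Obj C" "f \<in> Hom C x y" "g \<in> Hom C x y"
  shows "f = g"
proof -
  obtain j where j: "j \<in> Hom C w y" "Cmp C y w y j i = Ide C y" and i: "i \<in> Hom C y w"
    using assms(1) unfolding is_iso_def by blast
  have "Cmp C x y y (Cmp C y w y j i) f = Cmp C x y y (Cmp C y w y j i) g"
    using assms i j(1) by (simp add: cmp_assoc[symmetric] del: j(2))
  then show ?thesis using assms j by (simp add: cmp_ide_left)
qed

lemma iso_cancel_right: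
  assumes "is_iso C x y i" "Cmp C x y w f i = Cmp C x y w g i"
    and "x \<in> Obj C" "y \<in> Obj C" "w \<in> Obj C" "f \<in> Hom C y w" "g \<in> Hom C y w"
  shows "f = g"
proof -
  obtain j where j: "j \<in> Hom C y x" "Cmp C y x y i j = Ide C y" and i: "i \<in> Hom C x y"
    using assms(1) unfolding is_iso_def by blast
  have "Cmp C y y w f (Cmp C y x y i j) = Cmp C y y w g (Cmp C y x y i j)"
    using assms i j(1) by (simp add: cmp_assoc del: j(2))
  then show ?thesis using assms j by (simp add: cmp_ide_right)
qed

end

text \<open>A natural isomorphism of \<open>G \<circ> F\<close> with the identity, in either direction, recovers an arrow
\<open>f\<close> from \<open>F f\<close>: it conjugates \<open>f\<close> into \<open>G (F f)\<close>.\<close>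

lemma faithful_if_left_inverse:
  assumes "category C" "is_functor C D F" "is_functor D C G"
    and s: "nat_iso C C fident (fcompose G F) s"
    and xy: "x \<in> Obj C" "y \<in> Obj C" "f \<in> Hom C x y" "g \<in> Hom C x y" "FM F x y f = FM F x y g"
  shows "f = g"
proof -
  interpret category C by fact
  note [simp] = functorD[OF assms(2)] functorD[OF assms(3)]
  have nat: "Cmp C x y (FO G (FO F y)) (s y) h =
      Cmp C x (FO G (FO F x)) (FO G (FO F y)) (FM G (FO F x) (FO F y) (FM F x y h)) (s x)"
    if "h \<in> Hom C x y" for h
    using s xy that unfolding nat_iso_def nat_trans_def fident_def fcompose_def by simp
  have "is_iso C y (FO G (FO F y)) (s y)"
    using s xy unfolding nat_iso_def fident_def fcompose_def by simp
  moreover have "Cmp C x y (FO G (FO F y)) (s y) f = Cmp C x y (FO G (FO F y)) (s y) g"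
    by (simp only: nat[OF xy(3)] nat[OF xy(4)] xy(5))
  ultimately show ?thesis by (rule iso_cancel_left) (use xy in simp_all)
qed

lemma faithful_if_right_inverse:
  assumes "category C" "is_functor C D F" "is_functor D C G"
    and t: "nat_iso C C (fcompose G F) fident t"
    and xy: "x \<in> Obj C" "y \<in> Obj C" "f \<in> Hom C x y" "g \<in> Hom C x y" "FM F x y f = FM F x y g"
  shows "f = g"
proof -
  interpret category C by fact
  note [simp] = functorD[OF assms(2)] functorD[OF assms(3)]
  have nat: "Cmp C (FO G (FO F x)) x y h (t x) =
      Cmp C (FO G (FO F x)) (FO G (FO F y)) y (t y) (FM G (FO F x) (FO F y) (FM F x y h))"
    if "h \<in> Hom C x y" for h
    using t xy that unfolding nat_iso_def nat_trans_def fident_def fcompose_def by simp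
  have "is_iso C (FO G (FO F x)) x (t x)"
    using t xy unfolding nat_iso_def fident_def fcompose_def by simp
  moreover have "Cmp C (FO G (FO F x)) x y f (t x) = Cmp C (FO G (FO F x)) x y g (t x)"
    by (simp only: nat[OF xy(3)] nat[OF xy(4)] xy(5))
  ultimately show ?thesis by (rule iso_cancel_right) (use xy in simp_all)
qed

text \<open>The preimage of \<open>g\<close> is \<open>G g\<close> conjugated by the unit. This gives an \<open>f\<close> with \<open>G (F f) = G g\<close>,
and \<open>G\<close> is faithful because of the counit.\<close>

lemma equivalence_imp_fully_faithful:
  assumes C: "category C" and D: "category D" and F: "is_equivalence C D F"
  shows "fully_faithful C D F"
  unfolding fully_faithful_def
proof (intro ballI)
  fix x y g assume xy: "x \<in> Obj C" "y \<in> Obj C" and g: "g \<in> Hom D (FO F x) (FO F y)"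
  interpret category C by fact
  obtain G s t where F: "is_functor C D F" and G: "is_functor D C G"
    and s: "nat_iso C C fident (fcompose G F) s" and t: "nat_iso D D (fcompose F G) fident t"
    using F unfolding is_equivalence_def by blast
  note [simp] = functorD[OF F] functorD[OF G] xy g
  have sx: "is_iso C x (FO G (FO F x)) (s x)" and sy: "is_iso C y (FO G (FO F y)) (s y)"
    using s xy unfolding nat_iso_def fident_def fcompose_def by simp_all
  have sh [simp]: "s x \<in> Hom C x (FO G (FO F x))" "s y \<in> Hom C y (FO G (FO F y))"
    using sx sy unfolding is_iso_def by simp_all
  obtain j where j [simp]: "j \<in> Hom C (FO G (FO F y)) y"
    and inv: "Cmp C (FO G (FO F y)) y (FO G (FO F y)) (s y) j = Ide C (FO G (FO F y))"
    using sy unfolding is_iso_def by blast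
  define m where "m = Cmp C x (FO G (FO F x)) (FO G (FO F y)) (FM G (FO F x) (FO F y) g) (s x)"
  define f where "f = Cmp C x (FO G (FO F y)) y j m"
  have m [simp]: "m \<in> Hom C x (FO G (FO F y))" unfolding m_def by (simp add: cmp_in)
  have f [simp]: "f \<in> Hom C x y" unfolding f_def by (simp add: cmp_in)
  have "Cmp C x (FO G (FO F x)) (FO G (FO F y)) (FM G (FO F x) (FO F y) (FM F x y f)) (s x) =
      Cmp C x y (FO G (FO F y)) (s y) f"
    using s f xy unfolding nat_iso_def nat_trans_def fident_def fcompose_def by simp
  also have "\<dots> = m" unfolding f_def by (simp add: cmp_assoc inv cmp_ide_left)
  finally have "FM G (FO F x) (FO F y) (FM F x y f) = FM G (FO F x) (FO F y) g"
    unfolding m_def by (rule iso_cancel_right[OF sx]) simp_all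
  then have "FM F x y f = g" by (rule faithful_if_right_inverse[OF D G F t, rotated -1]) simp_all
  then show "\<exists>!f. f \<in> Hom C x y \<and> FM F x y f = g"
    using f by (intro ex1I[of _ f]) (simp, rule faithful_if_left_inverse[OF C F G s xy], simp_all)
qed

lemma equivalence_imp_essentially_surjective:
  assumes F: "is_equivalence C D F"
  shows "essentially_surjective C D F"
  unfolding essentially_surjective_def
proof
  fix d assume d: "d \<in> Obj D"
  obtain G t where G: "is_functor D C G" and t: "nat_iso D D (fcompose F G) fident t"
    using F unfolding is_equivalence_def by blast
  have "is_iso D (FO F (FO G d)) d (t d)"
    using t d unfolding nat_iso_def fident_def fcompose_def by simp
  then show "\<exists>c \<in> Obj C. isomorphic D (FO F c) d"
    using functor_obj[OF G d] unfolding isomorphic_def by blast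
qed

text \<open>A quasi-inverse \<open>G\<close> is obtained by choosing for every \<open>d\<close> an object \<open>c d\<close> with an isomorphism
\<open>i d : F (c d) \<rightarrow> d\<close> and conjugating arrows with it. All identities between arrows of the source
category are checked after applying \<open>F\<close>.\<close>

lemma equivalence_if_fully_faithful_essentially_surjective:
  assumes C: "category C" and D: "category D" and F: "is_functor C D F"
    and ff: "fully_faithful C D F" and es: "essentially_surjective C D F"
  shows "is_equivalence C D F"
proof -
  interpret C: category C by fact
  interpret D: category D by fact
  note F [simp] = functorD[OF F]
  have "\<forall>d \<in> Obj D. \<exists>c i j. c \<in> Obj C \<and> i \<in> Hom D (FO F c) d \<and> j \<in> Hom D d (FO F c) \<and>
      Cmp D (FO F c) d (FO F c) j i = Ide D (FO F c) \<and> Cmp D d (FO F c) d i j = Ide D d"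
    using es unfolding essentially_surjective_def isomorphic_def is_iso_def by blast
  then obtain c i j where [simp]: "\<And>d. d \<in> Obj D \<Longrightarrow> c d \<in> Obj C"
      "\<And>d. d \<in> Obj D \<Longrightarrow> i d \<in> Hom D (FO F (c d)) d"
      "\<And>d. d \<in> Obj D \<Longrightarrow> j d \<in> Hom D d (FO F (c d))"
    and ji: "\<And>d. d \<in> Obj D \<Longrightarrow> Cmp D (FO F (c d)) d (FO F (c d)) (j d) (i d) = Ide D (FO F (c d))"
    and ij: "\<And>d. d \<in> Obj D \<Longrightarrow> Cmp D d (FO F (c d)) d (i d) (j d) = Ide D d"
    by metis
  define lift where "lift x y g = (THE f. f \<in> Hom C x y \<and> FM F x y f = g)" for x y g
  have lift: "lift x y g \<in> Hom C x y" "FM F x y (lift x y g) = g"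
    if "x \<in> Obj C" "y \<in> Obj C" "g \<in> Hom D (FO F x) (FO F y)" for x y g
    using theI'[of "\<lambda>f. f \<in> Hom C x y \<and> FM F x y f = g"] ff that
    unfolding fully_faithful_def lift_def by blast+
  have inj: "f = g" if "x \<in> Obj C" "y \<in> Obj C" "f \<in> Hom C x y" "g \<in> Hom C x y"
      "FM F x y f = FM F x y g" for x y f g
  proof -
    have "FM F x y g \<in> Hom D (FO F x) (FO F y)" using that by simp
    then have "\<exists>!f. f \<in> Hom C x y \<and> FM F x y f = FM F x y g"
      using ff that unfolding fully_faithful_def by blast
    then show ?thesis using that by blast
  qed
  note [simp] = lift
  define conj where "conj d e g = Cmp D (FO F (c d)) e (FO F (c e)) (j e) (Cmp D (FO F (c d)) d e g (i d))"
    for d e g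
  have conj [simp]: "conj d e g \<in> Hom D (FO F (c d)) (FO F (c e))"
    if "d \<in> Obj D" "e \<in> Obj D" "g \<in> Hom D d e" for d e g
    unfolding conj_def using that by (simp add: D.cmp_in)
  define G where "G = \<lparr>FO = c, FM = (\<lambda>d e g. lift (c d) (c e) (conj d e g))\<rparr>"
  have i_conj: "Cmp D (FO F (c d)) (FO F (c e)) e (i e) (conj d e g) = Cmp D (FO F (c d)) d e g (i d)"
    if "d \<in> Obj D" "e \<in> Obj D" "g \<in> Hom D d e" for d e g
    unfolding conj_def using that by (simp add: D.cmp_in D.cmp_assoc ij D.cmp_ide_left)
  have conj_cmp: "conj d k (Cmp D d e k h g) =
      Cmp D (FO F (c d)) (FO F (c e)) (FO F (c k)) (conj e k h) (conj d e g)"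
    if "d \<in> Obj D" "e \<in> Obj D" "k \<in> Obj D" "g \<in> Hom D d e" "h \<in> Hom D e k" for d e k g h
  proof -
    have "Cmp D (FO F (c d)) (FO F (c e)) (FO F (c k)) (conj e k h) (conj d e g) =
        Cmp D (FO F (c d)) e (FO F (c k)) (Cmp D e k (FO F (c k)) (j k) h)
          (Cmp D (FO F (c d)) (FO F (c e)) e (i e) (conj d e g))"
      using that unfolding conj_def[of e k] by (simp add: D.cmp_in D.cmp_assoc)
    also have "\<dots> = conj d k (Cmp D d e k h g)"
      using that by (subst i_conj) (simp_all add: conj_def D.cmp_in D.cmp_assoc)
    finally show ?thesis by simp
  qed
  have "is_functor D C G"
    unfolding is_functor_def
  proof (intro conjI ballI)
    fix d assume d: "d \<in> Obj D"
    then have "conj d d (Ide D d) = Ide D (FO F (c d))"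
      by (simp add: conj_def D.ide_in D.cmp_ide_left ji)
    then show "FM G d d (Ide D d) = Ide C (FO G d)"
      using d by (intro inj[of "c d" "c d"]) (simp_all add: G_def D.ide_in C.ide_in)
  next
    fix d e k g h assume h: "d \<in> Obj D" "e \<in> Obj D" "k \<in> Obj D" "g \<in> Hom D d e" "h \<in> Hom D e k"
    show "FM G d k (Cmp D d e k h g) = Cmp C (FO G d) (FO G e) (FO G k) (FM G e k h) (FM G d e g)"
      using h conj_cmp[OF h]
      by (intro inj[of "c d" "c k"]) (simp_all add: G_def D.cmp_in C.cmp_in)
  qed (simp_all add: G_def)
  moreover have "nat_iso D D (fcompose F G) fident i"
    unfolding nat_iso_def nat_trans_def fident_def fcompose_def G_def fctr.simps
    by (intro conjI ballI is_isoI[OF _ _ ji ij]) (simp_all add: i_conj)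
  moreover have "nat_iso C C fident (fcompose G F) (\<lambda>x. lift x (c (FO F x)) (j (FO F x)))"
    unfolding nat_iso_def nat_trans_def fident_def fcompose_def G_def fctr.simps
  proof (intro conjI ballI)
    fix x y f assume xy: "x \<in> Obj C" "y \<in> Obj C" "f \<in> Hom C x y"
    let ?x = "FO F x" let ?y = "FO F y"
    have "Cmp D ?x (FO F (c ?x)) (FO F (c ?y)) (conj ?x ?y (FM F x y f)) (j ?x) =
        Cmp D ?x ?x (FO F (c ?y)) (Cmp D ?x ?y (FO F (c ?y)) (j ?y) (FM F x y f))
          (Cmp D ?x (FO F (c ?x)) ?x (i ?x) (j ?x))"
      using xy unfolding conj_def by (simp add: D.cmp_in D.cmp_assoc)
    also have "\<dots> = Cmp D ?x ?y (FO F (c ?y)) (j ?y) (FM F x y f)"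
      using xy by (simp add: ij D.cmp_ide_right D.cmp_in)
    finally show "Cmp C x y (c ?y) (lift y (c ?y) (j ?y)) f =
        Cmp C x (c ?x) (c ?y) (lift (c ?x) (c ?y) (conj ?x ?y (FM F x y f))) (lift x (c ?x) (j ?x))"
      using xy by (intro inj[of x "c ?y"]) (simp_all add: C.cmp_in)
  next
    fix x assume x: "x \<in> Obj C"
    let ?x = "FO F x"
    show "is_iso C x (c ?x) (lift x (c ?x) (j ?x))"
    proof (rule is_isoI)
      show "Cmp C x (c ?x) x (lift (c ?x) x (i ?x)) (lift x (c ?x) (j ?x)) = Ide C x"
        using x by (intro inj[of x x]) (simp_all add: C.cmp_in C.ide_in ij)
      show "Cmp C (c ?x) x (c ?x) (lift x (c ?x) (j ?x)) (lift (c ?x) x (i ?x)) = Ide C (c ?x)"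
        using x by (intro inj[of "c ?x" "c ?x"]) (simp_all add: C.cmp_in C.ide_in ji)
    qed (use x in simp_all)
  qed simp
  ultimately show ?thesis
    unfolding is_equivalence_def by (intro conjI exI assms(3))
qed

section \<open>Monadicity expressed through the left adjoint alone\<close>

text \<open>A universal arrow from \<open>L\<close> to \<open>y\<close> is the value at \<open>y\<close> of a right adjoint, together with the counit.
If \<open>L\<close> is composition with \<open>p\<close> between slices, it is a pullback along \<open>p\<close>.\<close>

definition universal_arrow ::
  "('o, 'm) cat \<Rightarrow> ('p, 'n) cat \<Rightarrow> ('o, 'm, 'p, 'n) fctr \<Rightarrow> 'p \<Rightarrow> 'o \<Rightarrow> 'n \<Rightarrow> bool" where
  "universal_arrow X Y L y r e \<longleftrightarrow> r \<in> Obj X \<and> e \<in> Hom Y (FO L r) y \<and>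
     (\<forall>w \<in> Obj X. \<forall>g \<in> Hom Y (FO L w) y.
        \<exists>!s. s \<in> Hom X w r \<and> Cmp Y (FO L w) (FO L r) y e (FM L w r s) = g)"

text \<open>The arrow \<open>e : L r \<rightarrow> y\<close> is the joint coequalizer of all pairs \<open>n, L s : L w \<rightarrow> L r\<close> that it identifies.
For a counit \<open>\<epsilon> y\<close> of an adjunction with right adjoint \<open>R\<close> this amounts to being the coequalizer of
\<open>\<epsilon> (L (R y))\<close> and \<open>L (R (\<epsilon> y))\<close>, the condition under which the comparison functor is fully faithful;
the present form avoids \<open>R\<close>.\<close>

definition effective_arrow ::
  "('o, 'm) cat \<Rightarrow> ('p, 'n) cat \<Rightarrow> ('o, 'm, 'p, 'n) fctr \<Rightarrow> 'p \<Rightarrow> 'o \<Rightarrow> 'n \<Rightarrow> bool" where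
  "effective_arrow X Y L y r e \<longleftrightarrow> (\<forall>v \<in> Obj Y. \<forall>\<phi> \<in> Hom Y (FO L r) v.
     (\<forall>w \<in> Obj X. \<forall>n \<in> Hom Y (FO L w) (FO L r). \<forall>s \<in> Hom X w r.
        Cmp Y (FO L w) (FO L r) y e n = Cmp Y (FO L w) (FO L r) y e (FM L w r s) \<longrightarrow>
        Cmp Y (FO L w) (FO L r) v \<phi> n = Cmp Y (FO L w) (FO L r) v \<phi> (FM L w r s)) \<longrightarrow>
     (\<exists>!k. k \<in> Hom Y y v \<and> Cmp Y (FO L r) y v k e = \<phi>))"

text \<open>An algebra \<open>h : R (L x) \<rightarrow> x\<close> of the monad induced by the adjunction of \<open>L\<close> and \<open>R\<close> with \<open>R\<close> eliminated: by adjunction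
\<open>h\<close> is the same as an operation that turns \<open>n : L w \<rightarrow> L x\<close> into \<open>\<theta> w n : w \<rightarrow> x\<close>, namely \<open>h\<close> composed
with the transpose of \<open>n\<close>. The second clause is the unit law, the third the associativity law; together
they imply naturality, \<open>\<theta> v (n \<circ> L s) = \<theta> w n \<circ> s\<close>.\<close>

definition descent_datum ::
  "('o, 'm) cat \<Rightarrow> ('p, 'n) cat \<Rightarrow> ('o, 'm, 'p, 'n) fctr \<Rightarrow> 'o \<Rightarrow> ('o \<Rightarrow> 'n \<Rightarrow> 'm) \<Rightarrow> bool" where
  "descent_datum X Y L x \<theta> \<longleftrightarrow>
     (\<forall>w \<in> Obj X. \<forall>n \<in> Hom Y (FO L w) (FO L x). \<theta> w n \<in> Hom X w x) \<and>
     (\<forall>w \<in> Obj X. \<forall>s \<in> Hom X w x. \<theta> w (FM L w x s) = s) \<and>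
     (\<forall>v \<in> Obj X. \<forall>w \<in> Obj X. \<forall>l \<in> Hom Y (FO L v) (FO L w). \<forall>n \<in> Hom Y (FO L w) (FO L x).
        \<theta> v (Cmp Y (FO L v) (FO L w) (FO L x) n l) =
        \<theta> v (Cmp Y (FO L v) (FO L w) (FO L x) (FM L w x (\<theta> w n)) l))"

text \<open>The algebra given by \<open>\<theta>\<close> lies in the essential image of the comparison functor: an isomorphism of its
carrier \<open>x\<close> with \<open>R y\<close> is the same as a universal arrow \<open>q : L x \<rightarrow> y\<close>, and it is an algebra map exactly
if \<open>q\<close> does not distinguish \<open>n\<close> from \<open>L (\<theta> w n)\<close>.\<close>

definition descent_realized ::
  "('o, 'm) cat \<Rightarrow> ('p, 'n) cat \<Rightarrow> ('o, 'm, 'p, 'n) fctr \<Rightarrow> 'o \<Rightarrow> ('o \<Rightarrow> 'n \<Rightarrow> 'm) \<Rightarrow> bool" where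
  "descent_realized X Y L x \<theta> \<longleftrightarrow> (\<exists>y q. y \<in> Obj Y \<and> universal_arrow X Y L y x q \<and>
     (\<forall>w \<in> Obj X. \<forall>n \<in> Hom Y (FO L w) (FO L x).
        Cmp Y (FO L w) (FO L x) y q (FM L w x (\<theta> w n)) = Cmp Y (FO L w) (FO L x) y q n))"

definition descends :: "('o, 'm) cat \<Rightarrow> ('p, 'n) cat \<Rightarrow> ('o, 'm, 'p, 'n) fctr \<Rightarrow> bool" where
  "descends X Y L \<longleftrightarrow>
     (\<forall>y \<in> Obj Y. \<exists>r e. universal_arrow X Y L y r e \<and> effective_arrow X Y L y r e) \<and>
     (\<forall>x \<in> Obj X. \<forall>\<theta>. descent_datum X Y L x \<theta> \<longrightarrow> descent_realized X Y L x \<theta>)"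

locale functor_between = X: category X + Y: category Y
  for X :: "('o, 'm) cat" and Y :: "('p, 'n) cat" +
  fixes L :: "('o, 'm, 'p, 'n) fctr"
  assumes is_functor: "is_functor X Y L"
begin

lemmas [simp] = functorD[OF is_functor] X.ide_in X.cmp_in X.cmp_ide_left X.cmp_ide_right
  Y.ide_in Y.cmp_in Y.cmp_ide_left Y.cmp_ide_right

lemma universal_arrowD:
  assumes "universal_arrow X Y L y r e"
  shows universal_arrow_obj: "r \<in> Obj X"
    and universal_arrow_hom: "e \<in> Hom Y (FO L r) y"
    and universal_arrow_ex: "\<lbrakk>w \<in> Obj X; g \<in> Hom Y (FO L w) y\<rbrakk> \<Longrightarrow>
      \<exists>s. s \<in> Hom X w r \<and> Cmp Y (FO L w) (FO L r) y e (FM L w r s) = g"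
    and universal_arrow_inj: "\<lbrakk>Cmp Y (FO L w) (FO L r) y e (FM L w r s) =
      Cmp Y (FO L w) (FO L r) y e (FM L w r t); w \<in> Obj X; y \<in> Obj Y; s \<in> Hom X w r; t \<in> Hom X w r\<rbrakk>
      \<Longrightarrow> s = t"
proof -
  note u = assms[unfolded universal_arrow_def]
  show r [simp]: "r \<in> Obj X" and e [simp]: "e \<in> Hom Y (FO L r) y" using u by blast+
  show "\<exists>s. s \<in> Hom X w r \<and> Cmp Y (FO L w) (FO L r) y e (FM L w r s) = g"
    if "w \<in> Obj X" "g \<in> Hom Y (FO L w) y"
    using u that by blast
  show "s = t" if eq: "Cmp Y (FO L w) (FO L r) y e (FM L w r s) =
      Cmp Y (FO L w) (FO L r) y e (FM L w r t)" and "w \<in> Obj X" "y \<in> Obj Y" "s \<in> Hom X w r" "t \<in> Hom X w r"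
  proof -
    have "Cmp Y (FO L w) (FO L r) y e (FM L w r t) \<in> Hom Y (FO L w) y" using that by simp
    then have "\<exists>!s. s \<in> Hom X w r \<and> Cmp Y (FO L w) (FO L r) y e (FM L w r s) =
        Cmp Y (FO L w) (FO L r) y e (FM L w r t)" using u that by blast
    then show ?thesis using that by blast
  qed
qed

lemma universal_arrow_iso:
  assumes u: "universal_arrow X Y L y r e" and y [simp]: "y \<in> Obj Y"
    and x [simp]: "x \<in> Obj X" and j [simp]: "j \<in> Hom X x r" and i [simp]: "i \<in> Hom X r x"
    and ij: "Cmp X x r x i j = Ide X x" and ji: "Cmp X r x r j i = Ide X r"
  shows "universal_arrow X Y L y x (Cmp Y (FO L x) (FO L r) y e (FM L x r j))"
  unfolding universal_arrow_def
proof (intro conjI ballI)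
  note [simp] = universal_arrow_obj[OF u] universal_arrow_hom[OF u]
  show "Cmp Y (FO L x) (FO L r) y e (FM L x r j) \<in> Hom Y (FO L x) y" by simp
  fix w g assume w [simp]: "w \<in> Obj X" and g: "g \<in> Hom Y (FO L w) y"
  have split: "Cmp Y (FO L w) (FO L x) y (Cmp Y (FO L x) (FO L r) y e (FM L x r j)) (FM L w x s) =
      Cmp Y (FO L w) (FO L r) y e (FM L w r (Cmp X w x r j s))" if "s \<in> Hom X w x" for s
    using that by (simp add: Y.cmp_assoc)
  obtain s where s [simp]: "s \<in> Hom X w r" and es: "Cmp Y (FO L w) (FO L r) y e (FM L w r s) = g"
    using universal_arrow_ex[OF u w g] by blast
  have jis: "Cmp X w x r j (Cmp X w r x i s) = s" by (simp add: X.cmp_assoc ji)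
  show "\<exists>!s. s \<in> Hom X w x \<and>
      Cmp Y (FO L w) (FO L x) y (Cmp Y (FO L x) (FO L r) y e (FM L x r j)) (FM L w x s) = g"
  proof (intro ex1I conjI)
    show "Cmp X w r x i s \<in> Hom X w x" by simp
    show "Cmp Y (FO L w) (FO L x) y (Cmp Y (FO L x) (FO L r) y e (FM L x r j))
        (FM L w x (Cmp X w r x i s)) = g"
      by (subst split) (simp_all only: jis es, simp)
    fix t assume "t \<in> Hom X w x \<and>
      Cmp Y (FO L w) (FO L x) y (Cmp Y (FO L x) (FO L r) y e (FM L x r j)) (FM L w x t) = g"
    then have t [simp]: "t \<in> Hom X w x"
      and "Cmp Y (FO L w) (FO L r) y e (FM L w r (Cmp X w x r j t)) =
        Cmp Y (FO L w) (FO L r) y e (FM L w r s)"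
      using split es by metis+
    from this(2) have "Cmp X w x r j t = s" by (rule universal_arrow_inj[OF u]) simp_all
    then have "Cmp X w r x i s = Cmp X w x x (Cmp X x r x i j) t" by (simp add: X.cmp_assoc[symmetric] del: ij)
    then show "t = Cmp X w r x i s" by (simp add: ij)
  qed
qed simp

end

locale adjoint_pair = functor_between X Y L
  for X :: "('o, 'm) cat" and Y :: "('p, 'n) cat" and L :: "('o, 'm, 'p, 'n) fctr" +
  fixes R :: "('p, 'n, 'o, 'm) fctr" and \<eta> :: "'o \<Rightarrow> 'm" and \<epsilon> :: "'p \<Rightarrow> 'n"
  assumes adjunction: "adjunction X Y L R \<eta> \<epsilon>"
begin

abbreviation EM :: "('o \<times> 'm, 'm) cat" where
  "EM \<equiv> eilenberg_moore X (induced_monad L R \<eta> \<epsilon>)"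

abbreviation K :: "('p, 'n, 'o \<times> 'm, 'm) fctr" where
  "K \<equiv> comparison L R \<epsilon>"

lemma right_is_functor: "is_functor Y X R"
  using adjunction unfolding adjunction_def by blast

lemmas [simp] = functorD[OF right_is_functor]

lemma
  shows unit_in [simp]: "x \<in> Obj X \<Longrightarrow> \<eta> x \<in> Hom X x (FO R (FO L x))"
    and counit_in [simp]: "y \<in> Obj Y \<Longrightarrow> \<epsilon> y \<in> Hom Y (FO L (FO R y)) y"
    and unit_natural: "\<lbrakk>x \<in> Obj X; w \<in> Obj X; s \<in> Hom X w x\<rbrakk> \<Longrightarrow>
      Cmp X w x (FO R (FO L x)) (\<eta> x) s =
      Cmp X w (FO R (FO L w)) (FO R (FO L x)) (FM R (FO L w) (FO L x) (FM L w x s)) (\<eta> w)"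
    and counit_natural: "\<lbrakk>y \<in> Obj Y; v \<in> Obj Y; k \<in> Hom Y y v\<rbrakk> \<Longrightarrow>
      Cmp Y (FO L (FO R y)) (FO L (FO R v)) v (\<epsilon> v) (FM L (FO R y) (FO R v) (FM R y v k)) =
      Cmp Y (FO L (FO R y)) y v k (\<epsilon> y)"
    and triangle_left [simp]: "x \<in> Obj X \<Longrightarrow>
      Cmp Y (FO L x) (FO L (FO R (FO L x))) (FO L x)
          (\<epsilon> (FO L x)) (FM L x (FO R (FO L x)) (\<eta> x)) = Ide Y (FO L x)"
    and triangle_right [simp]: "y \<in> Obj Y \<Longrightarrow>
      Cmp X (FO R y) (FO R (FO L (FO R y))) (FO R y)
          (FM R (FO L (FO R y)) y (\<epsilon> y)) (\<eta> (FO R y)) = Ide X (FO R y)"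
  using adjunction unfolding adjunction_def nat_trans_def fident_def fcompose_def by simp_all

definition transpose :: "'o \<Rightarrow> 'p \<Rightarrow> 'n \<Rightarrow> 'm" where
  "transpose w y g = Cmp X w (FO R (FO L w)) (FO R y) (FM R (FO L w) y g) (\<eta> w)"

lemma transpose_in [simp]:
  "\<lbrakk>w \<in> Obj X; y \<in> Obj Y; g \<in> Hom Y (FO L w) y\<rbrakk> \<Longrightarrow> transpose w y g \<in> Hom X w (FO R y)"
  by (simp add: transpose_def)

lemma counit_transpose:
  assumes [simp]: "w \<in> Obj X" "y \<in> Obj Y" "g \<in> Hom Y (FO L w) y"
  shows "Cmp Y (FO L w) (FO L (FO R y)) y (\<epsilon> y) (FM L w (FO R y) (transpose w y g)) = g"
proof -
  have "Cmp Y (FO L w) (FO L (FO R y)) y (\<epsilon> y) (FM L w (FO R y) (transpose w y g)) =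
      Cmp Y (FO L w) (FO L (FO R (FO L w))) y
        (Cmp Y (FO L (FO R (FO L w))) (FO L (FO R y)) y (\<epsilon> y)
          (FM L (FO R (FO L w)) (FO R y) (FM R (FO L w) y g)))
        (FM L w (FO R (FO L w)) (\<eta> w))"
    by (simp add: transpose_def Y.cmp_assoc)
  then show ?thesis by (simp add: counit_natural Y.cmp_assoc[symmetric])
qed

lemma transpose_counit:
  assumes [simp]: "w \<in> Obj X" "y \<in> Obj Y" "s \<in> Hom X w (FO R y)"
  shows "transpose w y (Cmp Y (FO L w) (FO L (FO R y)) y (\<epsilon> y) (FM L w (FO R y) s)) = s"
proof -
  have "transpose w y (Cmp Y (FO L w) (FO L (FO R y)) y (\<epsilon> y) (FM L w (FO R y) s)) =
      Cmp X w (FO R (FO L (FO R y))) (FO R y) (FM R (FO L (FO R y)) y (\<epsilon> y))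
        (Cmp X w (FO R y) (FO R (FO L (FO R y))) (\<eta> (FO R y)) s)"
    by (simp add: transpose_def unit_natural X.cmp_assoc)
  then show ?thesis by (simp add: X.cmp_assoc)
qed

lemma counit_universal:
  assumes y [simp]: "y \<in> Obj Y"
  shows "universal_arrow X Y L y (FO R y) (\<epsilon> y)"
  unfolding universal_arrow_def
proof (intro conjI ballI ex1I)
  fix w g assume [simp]: "w \<in> Obj X" "g \<in> Hom Y (FO L w) y"
  show "transpose w y g \<in> Hom X w (FO R y)" by simp
  show "Cmp Y (FO L w) (FO L (FO R y)) y (\<epsilon> y) (FM L w (FO R y) (transpose w y g)) = g"
    by (simp add: counit_transpose)
  fix s assume "s \<in> Hom X w (FO R y) \<and> Cmp Y (FO L w) (FO L (FO R y)) y (\<epsilon> y) (FM L w (FO R y) s) = g"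
  then show "s = transpose w y g" using transpose_counit[of w y s] by simp
qed simp_all

lemmas counit_inj = universal_arrow_inj[OF counit_universal, rotated]

lemma em_simps:
  "(x, h) \<in> Obj EM \<longleftrightarrow> x \<in> Obj X \<and> h \<in> Hom X (FO R (FO L x)) x \<and>
     Cmp X x (FO R (FO L x)) x h (\<eta> x) = Ide X x \<and>
     Cmp X (FO R (FO L (FO R (FO L x)))) (FO R (FO L x)) x h
       (FM R (FO L (FO R (FO L x))) (FO L x) (\<epsilon> (FO L x))) =
     Cmp X (FO R (FO L (FO R (FO L x)))) (FO R (FO L x)) x h
       (FM R (FO L (FO R (FO L x))) (FO L x) (FM L (FO R (FO L x)) x h))"
  "f \<in> Hom EM (x, h) (y, k) \<longleftrightarrow> f \<in> Hom X x y \<and>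
     Cmp X (FO R (FO L x)) x y f h =
     Cmp X (FO R (FO L x)) (FO R (FO L y)) y k (FM R (FO L x) (FO L y) (FM L x y f))"
  "Ide EM (x, h) = Ide X x"
  "Cmp EM (x, h) (y, k) (w, l) g f = Cmp X x y w g f"
  by (simp_all add: eilenberg_moore_def induced_monad_def fcompose_def Let_def)

lemma comparison_simps:
  "FO K y = (FO R y, FM R (FO L (FO R y)) y (\<epsilon> y))"
  "FM K y v k = FM R y v k"
  by (simp_all add: comparison_def)

lemma em_category: "category EM"
proof
  fix a b c f g assume "a \<in> Obj EM" "b \<in> Obj EM" "c \<in> Obj EM" "f \<in> Hom EM a b" "g \<in> Hom EM b c"
  moreover obtain x h y k w l where [simp]: "a = (x, h)" "b = (y, k)" "c = (w, l)"
    by (metis surj_pair)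
  ultimately have [simp]: "x \<in> Obj X" "y \<in> Obj X" "w \<in> Obj X" "f \<in> Hom X x y" "g \<in> Hom X y w"
      "h \<in> Hom X (FO R (FO L x)) x" "k \<in> Hom X (FO R (FO L y)) y" "l \<in> Hom X (FO R (FO L w)) w"
    and f: "Cmp X (FO R (FO L x)) x y f h =
      Cmp X (FO R (FO L x)) (FO R (FO L y)) y k (FM R (FO L x) (FO L y) (FM L x y f))"
    and g: "Cmp X (FO R (FO L y)) y w g k =
      Cmp X (FO R (FO L y)) (FO R (FO L w)) w l (FM R (FO L y) (FO L w) (FM L y w g))"
    by (simp_all add: em_simps)
  have "Cmp X (FO R (FO L x)) x w (Cmp X x y w g f) h =
      Cmp X (FO R (FO L x)) (FO R (FO L y)) w (Cmp X (FO R (FO L y)) y w g k)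
        (FM R (FO L x) (FO L y) (FM L x y f))"
    by (simp add: X.cmp_assoc[symmetric] f)
  also have "\<dots> = Cmp X (FO R (FO L x)) (FO R (FO L w)) w l
      (FM R (FO L x) (FO L w) (FM L x w (Cmp X x y w g f)))"
    unfolding g by (simp add: X.cmp_assoc)
  finally show "Cmp EM a b c g f \<in> Hom EM a c" by (simp add: em_simps)
qed (auto simp: em_simps intro: X.cmp_assoc)

text \<open>Transposing both sides of the equation for an algebra map \<open>j\<close> from \<open>(x, h)\<close> to the algebra of \<open>y\<close>
removes the outer \<open>R\<close>. The equation then says that the transpose \<open>q : L x \<rightarrow> y\<close> of \<open>j\<close> coequalizes
\<open>L h\<close> and \<open>\<epsilon> (L x)\<close>.\<close>

lemma algebra_map_iff:
  assumes [simp]: "x \<in> Obj X" "y \<in> Obj Y" "h \<in> Hom X (FO R (FO L x)) x" "j \<in> Hom X x (FO R y)"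
  shows "Cmp X (FO R (FO L x)) x (FO R y) j h =
      Cmp X (FO R (FO L x)) (FO R (FO L (FO R y))) (FO R y) (FM R (FO L (FO R y)) y (\<epsilon> y))
        (FM R (FO L x) (FO L (FO R y)) (FM L x (FO R y) j)) \<longleftrightarrow>
    Cmp Y (FO L (FO R (FO L x))) (FO L x) y
      (Cmp Y (FO L x) (FO L (FO R y)) y (\<epsilon> y) (FM L x (FO R y) j)) (FM L (FO R (FO L x)) x h) =
    Cmp Y (FO L (FO R (FO L x))) (FO L x) y
      (Cmp Y (FO L x) (FO L (FO R y)) y (\<epsilon> y) (FM L x (FO R y) j)) (\<epsilon> (FO L x))"
    (is "?l = ?r \<longleftrightarrow> ?l' = ?r'")
proof -
  let ?q = "Cmp Y (FO L x) (FO L (FO R y)) y (\<epsilon> y) (FM L x (FO R y) j)"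
  let ?e = "\<lambda>s. Cmp Y (FO L (FO R (FO L x))) (FO L (FO R y)) y (\<epsilon> y) (FM L (FO R (FO L x)) (FO R y) s)"
  have l: "?e ?l = ?l'" by (simp add: Y.cmp_assoc)
  have "?e (FM R (FO L x) y ?q) = ?r'" by (rule counit_natural) simp_all
  moreover have "?r = FM R (FO L x) y ?q" by simp
  ultimately have r: "?e ?r = ?r'" by (simp only:)
  show ?thesis
  proof
    assume "?l = ?r"
    then have "?e ?l = ?e ?r" by (simp only:)
    then show "?l' = ?r'" unfolding l r .
  next
    assume "?l' = ?r'"
    then have "?e ?l = ?e ?r" unfolding l r .
    then show "?l = ?r" by (rule counit_inj) simp_all
  qed
qed

end

context adjoint_pair begin

lemma comparison_is_functor: "is_functor Y EM K"
  unfolding is_functor_def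
proof (intro conjI ballI)
  fix y assume [simp]: "y \<in> Obj Y"
  have "Cmp Y (FO L (FO R (FO L (FO R y)))) (FO L (FO R y)) y (\<epsilon> y)
      (FM L (FO R (FO L (FO R y))) (FO R y) (FM R (FO L (FO R y)) y (\<epsilon> y))) =
    Cmp Y (FO L (FO R (FO L (FO R y)))) (FO L (FO R y)) y (\<epsilon> y) (\<epsilon> (FO L (FO R y)))"
    by (rule counit_natural) simp_all
  then have "FM R (FO L (FO R (FO L (FO R y)))) y
      (Cmp Y (FO L (FO R (FO L (FO R y)))) (FO L (FO R y)) y (\<epsilon> y)
        (FM L (FO R (FO L (FO R y))) (FO R y) (FM R (FO L (FO R y)) y (\<epsilon> y)))) =
    FM R (FO L (FO R (FO L (FO R y)))) y
      (Cmp Y (FO L (FO R (FO L (FO R y)))) (FO L (FO R y)) y (\<epsilon> y) (\<epsilon> (FO L (FO R y))))"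
    by (simp only:)
  then show "FO K y \<in> Obj EM" by (simp add: comparison_simps em_simps)
next
  fix y v k assume [simp]: "y \<in> Obj Y" "v \<in> Obj Y" "k \<in> Hom Y y v"
  have "FM R (FO L (FO R y)) v
      (Cmp Y (FO L (FO R y)) (FO L (FO R v)) v (\<epsilon> v) (FM L (FO R y) (FO R v) (FM R y v k))) =
      FM R (FO L (FO R y)) v (Cmp Y (FO L (FO R y)) y v k (\<epsilon> y))"
    by (simp only: counit_natural \<open>y \<in> Obj Y\<close> \<open>v \<in> Obj Y\<close> \<open>k \<in> Hom Y y v\<close>)
  then show "FM K y v k \<in> Hom EM (FO K y) (FO K v)" by (simp add: comparison_simps em_simps)
qed (simp_all add: comparison_simps em_simps)

text \<open>An arrow \<open>\<phi>\<close> that respects the identifications made by \<open>\<epsilon> y\<close> coequalizes in particular the pair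
\<open>\<epsilon> (L (R y))\<close>, \<open>L (R (\<epsilon> y))\<close>. So its transpose is an algebra map, hence of the form \<open>R k\<close>.\<close>

lemma comparison_fully_faithful_imp_effective:
  assumes ff: "fully_faithful Y EM K" and y [simp]: "y \<in> Obj Y"
  shows "effective_arrow X Y L y (FO R y) (\<epsilon> y)"
  unfolding effective_arrow_def
proof (intro ballI impI)
  fix v \<phi> assume v [simp]: "v \<in> Obj Y" and \<phi> [simp]: "\<phi> \<in> Hom Y (FO L (FO R y)) v"
  assume eq: "\<forall>w \<in> Obj X. \<forall>n \<in> Hom Y (FO L w) (FO L (FO R y)). \<forall>s \<in> Hom X w (FO R y).
    Cmp Y (FO L w) (FO L (FO R y)) y (\<epsilon> y) n = Cmp Y (FO L w) (FO L (FO R y)) y (\<epsilon> y) (FM L w (FO R y) s) \<longrightarrow>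
    Cmp Y (FO L w) (FO L (FO R y)) v \<phi> n = Cmp Y (FO L w) (FO L (FO R y)) v \<phi> (FM L w (FO R y) s)"
  define f where "f = transpose (FO R y) v \<phi>"
  have f [simp]: "f \<in> Hom X (FO R y) (FO R v)" unfolding f_def by simp
  have \<phi>_eq: "Cmp Y (FO L (FO R y)) (FO L (FO R v)) v (\<epsilon> v) (FM L (FO R y) (FO R v) f) = \<phi>"
    unfolding f_def by (simp add: counit_transpose)
  have "Cmp Y (FO L (FO R (FO L (FO R y)))) (FO L (FO R y)) v \<phi> (\<epsilon> (FO L (FO R y))) =
      Cmp Y (FO L (FO R (FO L (FO R y)))) (FO L (FO R y)) v \<phi>
        (FM L (FO R (FO L (FO R y))) (FO R y) (FM R (FO L (FO R y)) y (\<epsilon> y)))"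
    by (rule eq[rule_format]) (simp_all add: counit_natural)
  then have "f \<in> Hom EM (FO K y) (FO K v)"
    by (simp add: comparison_simps em_simps algebra_map_iff \<phi>_eq)
  then obtain k where k [simp]: "k \<in> Hom Y y v" "FM R y v k = f"
    using ff y v unfolding fully_faithful_def comparison_simps by blast
  show "\<exists>!k. k \<in> Hom Y y v \<and> Cmp Y (FO L (FO R y)) y v k (\<epsilon> y) = \<phi>"
  proof (intro ex1I conjI)
    show "Cmp Y (FO L (FO R y)) y v k (\<epsilon> y) = \<phi>"
      using counit_natural[of y v k] by (simp add: \<phi>_eq)
    fix l assume l: "l \<in> Hom Y y v \<and> Cmp Y (FO L (FO R y)) y v l (\<epsilon> y) = \<phi>"
    then have "Cmp Y (FO L (FO R y)) (FO L (FO R v)) v (\<epsilon> v) (FM L (FO R y) (FO R v) (FM R y v l)) =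
      Cmp Y (FO L (FO R y)) (FO L (FO R v)) v (\<epsilon> v) (FM L (FO R y) (FO R v) f)"
      by (simp add: counit_natural \<phi>_eq)
    then have "FM R y v l = f" using l by (elim counit_inj) simp_all
    moreover have "FM K y v k \<in> Hom EM (FO K y) (FO K v)"
      by (rule functor_hom[OF comparison_is_functor]) simp_all
    ultimately show "l = k"
      using ff l k y v unfolding fully_faithful_def comparison_simps by metis
  qed simp
qed

text \<open>Conversely, every pair \<open>n, L s\<close> identified by \<open>\<epsilon> y\<close> factors through the pair
\<open>\<epsilon> (L (R y))\<close>, \<open>L (R (\<epsilon> y))\<close>, by \<open>L m\<close> for the transpose \<open>m\<close> of \<open>n\<close>. So the transpose of an algebra map
respects all identifications that effectiveness asks for.\<close>

lemma effective_imp_comparison_fully_faithful: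
  assumes eff: "\<And>y. y \<in> Obj Y \<Longrightarrow> effective_arrow X Y L y (FO R y) (\<epsilon> y)"
  shows "fully_faithful Y EM K"
  unfolding fully_faithful_def
proof (intro ballI)
  fix y v g assume y [simp]: "y \<in> Obj Y" and v [simp]: "v \<in> Obj Y" and g: "g \<in> Hom EM (FO K y) (FO K v)"
  then have g' [simp]: "g \<in> Hom X (FO R y) (FO R v)" by (simp add: comparison_simps em_simps)
  define \<phi> where "\<phi> = Cmp Y (FO L (FO R y)) (FO L (FO R v)) v (\<epsilon> v) (FM L (FO R y) (FO R v) g)"
  have \<phi> [simp]: "\<phi> \<in> Hom Y (FO L (FO R y)) v" unfolding \<phi>_def by simp
  have fork: "Cmp Y (FO L (FO R (FO L (FO R y)))) (FO L (FO R y)) v \<phi>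
        (FM L (FO R (FO L (FO R y))) (FO R y) (FM R (FO L (FO R y)) y (\<epsilon> y))) =
      Cmp Y (FO L (FO R (FO L (FO R y)))) (FO L (FO R y)) v \<phi> (\<epsilon> (FO L (FO R y)))"
    using g by (simp add: comparison_simps em_simps algebra_map_iff \<phi>_def)
  have "Cmp Y (FO L w) (FO L (FO R y)) v \<phi> n = Cmp Y (FO L w) (FO L (FO R y)) v \<phi> (FM L w (FO R y) s)"
    if [simp]: "w \<in> Obj X" "n \<in> Hom Y (FO L w) (FO L (FO R y))" "s \<in> Hom X w (FO R y)"
      and eq: "Cmp Y (FO L w) (FO L (FO R y)) y (\<epsilon> y) n =
        Cmp Y (FO L w) (FO L (FO R y)) y (\<epsilon> y) (FM L w (FO R y) s)" for w n s
  proof -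
    define m where "m = transpose w (FO L (FO R y)) n"
    have m [simp]: "m \<in> Hom X w (FO R (FO L (FO R y)))" unfolding m_def by simp
    have n: "Cmp Y (FO L w) (FO L (FO R (FO L (FO R y)))) (FO L (FO R y)) (\<epsilon> (FO L (FO R y)))
        (FM L w (FO R (FO L (FO R y))) m) = n"
      unfolding m_def by (simp add: counit_transpose)
    let ?s = "Cmp X w (FO R (FO L (FO R y))) (FO R y) (FM R (FO L (FO R y)) y (\<epsilon> y)) m"
    have "Cmp Y (FO L w) (FO L (FO R y)) y (\<epsilon> y) (FM L w (FO R y) ?s) =
        Cmp Y (FO L w) (FO L (FO R (FO L (FO R y)))) y
          (Cmp Y (FO L (FO R (FO L (FO R y)))) (FO L (FO R y)) y (\<epsilon> y) (\<epsilon> (FO L (FO R y))))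
          (FM L w (FO R (FO L (FO R y))) m)"
      by (simp add: Y.cmp_assoc counit_natural)
    also have "\<dots> = Cmp Y (FO L w) (FO L (FO R y)) y (\<epsilon> y) (FM L w (FO R y) s)"
      by (simp add: Y.cmp_assoc[symmetric] n eq)
    finally have "?s = s" by (rule counit_inj) simp_all
    then have "Cmp Y (FO L w) (FO L (FO R y)) v \<phi> (FM L w (FO R y) s) =
        Cmp Y (FO L w) (FO L (FO R y)) v \<phi> (FM L w (FO R y) ?s)" by (simp only:)
    also have "\<dots> = Cmp Y (FO L w) (FO L (FO R (FO L (FO R y)))) v
        (Cmp Y (FO L (FO R (FO L (FO R y)))) (FO L (FO R y)) v \<phi>
          (FM L (FO R (FO L (FO R y))) (FO R y) (FM R (FO L (FO R y)) y (\<epsilon> y))))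
        (FM L w (FO R (FO L (FO R y))) m)"
      by (simp add: Y.cmp_assoc)
    also have "\<dots> = Cmp Y (FO L w) (FO L (FO R y)) v \<phi> n"
      unfolding fork by (simp add: Y.cmp_assoc[symmetric] n)
    finally show ?thesis by simp
  qed
  then have ex1: "\<exists>!k. k \<in> Hom Y y v \<and> Cmp Y (FO L (FO R y)) y v k (\<epsilon> y) = \<phi>"
    using eff[OF y] v \<phi> unfolding effective_arrow_def by blast
  have "FM R y v k = g \<longleftrightarrow> Cmp Y (FO L (FO R y)) y v k (\<epsilon> y) = \<phi>" if [simp]: "k \<in> Hom Y y v" for k
    unfolding counit_natural[OF y v that, symmetric] \<phi>_def
    using counit_inj[where w = "FO R y" and y = v and s = "FM R y v k" and t = g] by auto
  then show "\<exists>!k. k \<in> Hom Y y v \<and> FM K y v k = g" using ex1 unfolding comparison_simps by blast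
qed

text \<open>The algebra of a descent datum is its value at the counit, \<open>h = \<theta> (R (L x)) (\<epsilon> (L x))\<close>. If \<open>j\<close> is an
isomorphism from \<open>(x, h)\<close> to the algebra of \<open>y\<close>, its transpose realizes the descent datum.\<close>

lemma comparison_essentially_surjective_imp_realized:
  assumes es: "essentially_surjective Y EM K" and x [simp]: "x \<in> Obj X"
    and datum: "descent_datum X Y L x \<theta>"
  shows "descent_realized X Y L x \<theta>"
proof -
  define h where "h = \<theta> (FO R (FO L x)) (\<epsilon> (FO L x))"
  have \<theta>_in [simp]: "\<theta> w n \<in> Hom X w x" if "w \<in> Obj X" "n \<in> Hom Y (FO L w) (FO L x)" for w n
    using datum that unfolding descent_datum_def by blast
  have \<theta>_L: "\<theta> w (FM L w x s) = s" if "w \<in> Obj X" "s \<in> Hom X w x" for w s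
    using datum that unfolding descent_datum_def by blast
  have \<theta>_cmp: "\<theta> v (Cmp Y (FO L v) (FO L w) (FO L x) n l) =
      \<theta> v (Cmp Y (FO L v) (FO L w) (FO L x) (FM L w x (\<theta> w n)) l)"
    if "v \<in> Obj X" "w \<in> Obj X" "l \<in> Hom Y (FO L v) (FO L w)" "n \<in> Hom Y (FO L w) (FO L x)" for v w l n
    using datum that unfolding descent_datum_def by blast
  have h [simp]: "h \<in> Hom X (FO R (FO L x)) x" unfolding h_def by simp
  have \<theta>_h: "\<theta> w n = Cmp X w (FO R (FO L x)) x h (transpose w (FO L x) n)"
    if [simp]: "w \<in> Obj X" "n \<in> Hom Y (FO L w) (FO L x)" for w n
  proof -
    let ?m = "transpose w (FO L x) n"
    have "\<theta> w n = \<theta> w (Cmp Y (FO L w) (FO L (FO R (FO L x))) (FO L x) (\<epsilon> (FO L x)) (FM L w (FO R (FO L x)) ?m))"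
      by (simp add: counit_transpose)
    also have "\<dots> = \<theta> w (FM L w x (Cmp X w (FO R (FO L x)) x h ?m))"
      by (subst \<theta>_cmp) (simp_all add: h_def)
    also have "\<dots> = Cmp X w (FO R (FO L x)) x h ?m" by (rule \<theta>_L) simp_all
    finally show ?thesis .
  qed
  \<comment> \<open>unit law: evaluate \<open>\<theta>\<close> at the identity of \<open>L x\<close>\<close>
  have "\<theta> x (FM L x x (Ide X x)) = Cmp X x (FO R (FO L x)) x h (\<eta> x)"
    by (subst \<theta>_h) (simp_all add: transpose_def)
  then have unit: "Cmp X x (FO R (FO L x)) x h (\<eta> x) = Ide X x"
    by (simp only: \<theta>_L x X.ide_in)
  let ?T = "\<lambda>x. FO R (FO L x)"
  \<comment> \<open>associativity law: both composites are \<open>\<theta>\<close> at the same arrow, by naturality of \<open>\<epsilon>\<close>\<close>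
  have "\<theta> (?T (?T x)) (Cmp Y (FO L (?T (?T x))) (FO L (?T x)) (FO L x) (\<epsilon> (FO L x)) (\<epsilon> (FO L (?T x)))) =
      Cmp X (?T (?T x)) (?T x) x h (FM R (FO L (?T x)) (FO L x) (FM L (?T x) x h))"
    by (subst \<theta>_cmp) (simp_all add: \<theta>_h transpose_def h_def[symmetric] X.cmp_assoc[symmetric])
  moreover have "\<theta> (?T (?T x)) (Cmp Y (FO L (?T (?T x))) (FO L (?T x)) (FO L x) (\<epsilon> (FO L x))
        (FM L (?T (?T x)) (?T x) (FM R (FO L (?T x)) (FO L x) (\<epsilon> (FO L x))))) =
      Cmp X (?T (?T x)) (?T x) x h (FM R (FO L (?T x)) (FO L x) (\<epsilon> (FO L x)))"
    by (subst \<theta>_h) (simp_all add: transpose_counit)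
  moreover have "Cmp Y (FO L (?T (?T x))) (FO L (?T x)) (FO L x) (\<epsilon> (FO L x))
        (FM L (?T (?T x)) (?T x) (FM R (FO L (?T x)) (FO L x) (\<epsilon> (FO L x)))) =
      Cmp Y (FO L (?T (?T x))) (FO L (?T x)) (FO L x) (\<epsilon> (FO L x)) (\<epsilon> (FO L (?T x)))"
    by (rule counit_natural) simp_all
  ultimately have "(x, h) \<in> Obj EM" unfolding em_simps by (simp add: unit)
  then obtain y f where y [simp]: "y \<in> Obj Y" and "is_iso EM (FO K y) (x, h) f"
    using es unfolding essentially_surjective_def isomorphic_def by blast
  then obtain j where f [simp]: "f \<in> Hom X (FO R y) x" and j [simp]: "j \<in> Hom X x (FO R y)"
    and fj: "Cmp X x (FO R y) x f j = Ide X x" and jf: "Cmp X (FO R y) x (FO R y) j f = Ide X (FO R y)"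
    and jh: "Cmp X (FO R (FO L x)) x (FO R y) j h =
      Cmp X (FO R (FO L x)) (FO R (FO L (FO R y))) (FO R y) (FM R (FO L (FO R y)) y (\<epsilon> y))
        (FM R (FO L x) (FO L (FO R y)) (FM L x (FO R y) j))"
    unfolding is_iso_def by (auto simp: em_simps comparison_simps)
  define q where "q = Cmp Y (FO L x) (FO L (FO R y)) y (\<epsilon> y) (FM L x (FO R y) j)"
  have q [simp]: "q \<in> Hom Y (FO L x) y" unfolding q_def by simp
  have "universal_arrow X Y L y x q"
    unfolding q_def by (rule universal_arrow_iso[OF counit_universal _ _ _ f fj jf]) simp_all
  moreover have qh: "Cmp Y (FO L (?T x)) (FO L x) y q (FM L (?T x) x h) =
      Cmp Y (FO L (?T x)) (FO L x) y q (\<epsilon> (FO L x))"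
    using jh by (simp add: algebra_map_iff q_def)
  have "Cmp Y (FO L w) (FO L x) y q (FM L w x (\<theta> w n)) = Cmp Y (FO L w) (FO L x) y q n"
    if [simp]: "w \<in> Obj X" "n \<in> Hom Y (FO L w) (FO L x)" for w n
  proof -
    let ?m = "transpose w (FO L x) n"
    have "Cmp Y (FO L w) (FO L x) y q (FM L w x (\<theta> w n)) = Cmp Y (FO L w) (FO L (?T x)) y
        (Cmp Y (FO L (?T x)) (FO L x) y q (FM L (?T x) x h)) (FM L w (?T x) ?m)"
      by (simp add: \<theta>_h Y.cmp_assoc)
    then show ?thesis unfolding qh by (simp add: Y.cmp_assoc[symmetric] counit_transpose)
  qed
  ultimately show ?thesis unfolding descent_realized_def using y by blast
qed

text \<open>An algebra \<open>(x, h)\<close> yields the descent datum \<open>\<theta> w n = h \<circ> transpose n\<close>. The arrow \<open>q : L x \<rightarrow> y\<close> that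
realizes it and the counit \<open>\<epsilon> y\<close> are both universal, so \<open>x\<close> and \<open>R y\<close> are isomorphic.\<close>

lemma realized_imp_comparison_essentially_surjective:
  assumes real: "\<And>x \<theta>. \<lbrakk>x \<in> Obj X; descent_datum X Y L x \<theta>\<rbrakk> \<Longrightarrow> descent_realized X Y L x \<theta>"
  shows "essentially_surjective Y EM K"
  unfolding essentially_surjective_def
proof
  let ?T = "\<lambda>x. FO R (FO L x)"
  fix xh assume "xh \<in> Obj EM"
  moreover obtain x h where xh: "xh = (x, h)" by fastforce
  ultimately have x [simp]: "x \<in> Obj X" and h [simp]: "h \<in> Hom X (?T x) x"
    and unit: "Cmp X x (?T x) x h (\<eta> x) = Ide X x"
    and mult: "Cmp X (?T (?T x)) (?T x) x h (FM R (FO L (?T x)) (FO L x) (\<epsilon> (FO L x))) =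
      Cmp X (?T (?T x)) (?T x) x h (FM R (FO L (?T x)) (FO L x) (FM L (?T x) x h))"
    by (simp_all add: em_simps)
  define \<theta> where "\<theta> w n = Cmp X w (?T x) x h (transpose w (FO L x) n)" for w n
  have \<theta>_in [simp]: "\<theta> w n \<in> Hom X w x" if "w \<in> Obj X" "n \<in> Hom Y (FO L w) (FO L x)" for w n
    using that unfolding \<theta>_def by simp
  \<comment> \<open>the associativity law of \<open>h\<close> says that \<open>h\<close> does not distinguish \<open>R n\<close> from \<open>R (L (\<theta> w n))\<close>\<close>
  have absorb: "Cmp X (?T w) (?T x) x h (FM R (FO L w) (FO L x) n) =
      Cmp X (?T w) (?T x) x h (FM R (FO L w) (FO L x) (FM L w x (\<theta> w n)))"
    if [simp]: "w \<in> Obj X" "n \<in> Hom Y (FO L w) (FO L x)" for w n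
  proof -
    let ?m = "transpose w (FO L x) n"
    have "FM R (FO L w) (FO L x) n = FM R (FO L w) (FO L x)
        (Cmp Y (FO L w) (FO L (?T x)) (FO L x) (\<epsilon> (FO L x)) (FM L w (?T x) ?m))"
      by (simp add: counit_transpose del: functor_cmp)
    then have "Cmp X (?T w) (?T x) x h (FM R (FO L w) (FO L x) n) =
      Cmp X (?T w) (?T (?T x)) x
        (Cmp X (?T (?T x)) (?T x) x h (FM R (FO L (?T x)) (FO L x) (\<epsilon> (FO L x))))
        (FM R (FO L w) (FO L (?T x)) (FM L w (?T x) ?m))"
      by (simp add: X.cmp_assoc)
    then show ?thesis unfolding mult by (simp add: \<theta>_def X.cmp_assoc)
  qed
  have "descent_datum X Y L x \<theta>"
    unfolding descent_datum_def
  proof (intro conjI ballI)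
    fix w s assume [simp]: "w \<in> Obj X" "s \<in> Hom X w x"
    show "\<theta> w (FM L w x s) = s"
      unfolding \<theta>_def transpose_def
      by (subst unit_natural[symmetric]) (simp_all add: X.cmp_assoc unit)
  next
    fix v w l n assume [simp]: "v \<in> Obj X" "w \<in> Obj X" "l \<in> Hom Y (FO L v) (FO L w)" "n \<in> Hom Y (FO L w) (FO L x)"
    show "\<theta> v (Cmp Y (FO L v) (FO L w) (FO L x) n l) =
        \<theta> v (Cmp Y (FO L v) (FO L w) (FO L x) (FM L w x (\<theta> w n)) l)"
      unfolding \<theta>_def[of v] transpose_def
      by (simp add: X.cmp_assoc absorb)
  qed simp
  then obtain y q where y [simp]: "y \<in> Obj Y" and u: "universal_arrow X Y L y x q"
    and q\<theta>: "\<And>w n. \<lbrakk>w \<in> Obj X; n \<in> Hom Y (FO L w) (FO L x)\<rbrakk> \<Longrightarrow>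
        Cmp Y (FO L w) (FO L x) y q (FM L w x (\<theta> w n)) = Cmp Y (FO L w) (FO L x) y q n"
    using real[OF x] unfolding descent_realized_def by blast
  have q [simp]: "q \<in> Hom Y (FO L x) y" using universal_arrow_hom[OF u] .
  \<comment> \<open>the datum evaluated at the counit returns \<open>h\<close>, as the transpose of the counit is an identity\<close>
  have "\<theta> (?T x) (\<epsilon> (FO L x)) = h"
    using transpose_counit[of "?T x" "FO L x" "Ide X (?T x)"] by (simp add: \<theta>_def)
  then have qh: "Cmp Y (FO L (?T x)) (FO L x) y q (FM L (?T x) x h) =
      Cmp Y (FO L (?T x)) (FO L x) y q (\<epsilon> (FO L x))"
    using q\<theta>[of "?T x" "\<epsilon> (FO L x)"] by simp
  define j where "j = transpose x y q"
  have j [simp]: "j \<in> Hom X x (FO R y)" unfolding j_def by simp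
  have \<epsilon>j: "Cmp Y (FO L x) (FO L (FO R y)) y (\<epsilon> y) (FM L x (FO R y) j) = q"
    unfolding j_def by (simp add: counit_transpose)
  obtain i where i [simp]: "i \<in> Hom X (FO R y) x"
    and qi: "Cmp Y (FO L (FO R y)) (FO L x) y q (FM L (FO R y) x i) = \<epsilon> y"
    using universal_arrow_ex[OF u, of "FO R y" "\<epsilon> y"] by auto
  have "Cmp Y (FO L (FO R y)) (FO L (FO R y)) y (\<epsilon> y) (FM L (FO R y) (FO R y) (Cmp X (FO R y) x (FO R y) j i)) =
      Cmp Y (FO L (FO R y)) (FO L (FO R y)) y (\<epsilon> y) (FM L (FO R y) (FO R y) (Ide X (FO R y)))"
    by (simp add: Y.cmp_assoc \<epsilon>j qi)
  then have ji: "Cmp X (FO R y) x (FO R y) j i = Ide X (FO R y)"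
    by (rule counit_inj) simp_all
  have "Cmp Y (FO L x) (FO L x) y q (FM L x x (Cmp X x (FO R y) x i j)) =
      Cmp Y (FO L x) (FO L x) y q (FM L x x (Ide X x))"
    by (simp add: Y.cmp_assoc \<epsilon>j qi)
  then have ij: "Cmp X x (FO R y) x i j = Ide X x"
    by (rule universal_arrow_inj[OF u]) simp_all
  have jh: "Cmp X (?T x) x (FO R y) j h =
      Cmp X (?T x) (FO R (FO L (FO R y))) (FO R y) (FM R (FO L (FO R y)) y (\<epsilon> y))
        (FM R (FO L x) (FO L (FO R y)) (FM L x (FO R y) j))"
    by (simp add: algebra_map_iff \<epsilon>j qh)
  \<comment> \<open>the inverse of an invertible algebra map is an algebra map\<close>
  let ?Ti = "FM R (FO L (FO R y)) (FO L x) (FM L (FO R y) x i)"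
  have Tji: "Cmp X (?T (FO R y)) (?T x) (?T (FO R y)) (FM R (FO L x) (FO L (FO R y)) (FM L x (FO R y) j)) ?Ti =
      Ide X (?T (FO R y))"
    using arg_cong[OF ji, of "\<lambda>f. FM R (FO L (FO R y)) (FO L (FO R y)) (FM L (FO R y) (FO R y) f)"] by simp
  have "Cmp X (?T (FO R y)) (FO R y) x i (FM R (FO L (FO R y)) y (\<epsilon> y)) =
      Cmp X (?T (FO R y)) (?T x) x (Cmp X (?T x) (FO R y) x i (Cmp X (?T x) x (FO R y) j h)) ?Ti"
    unfolding jh by (simp add: X.cmp_assoc[symmetric] Tji)
  also have "\<dots> = Cmp X (?T (FO R y)) (?T x) x h ?Ti"
    by (simp add: X.cmp_assoc ij)
  finally have "is_iso EM (FO K y) xh i"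
    unfolding xh by (intro is_isoI[where g = j]) (simp_all add: em_simps comparison_simps jh ij ji)
  then show "\<exists>y \<in> Obj Y. isomorphic EM (FO K y) xh" unfolding isomorphic_def using y by blast
qed

lemma monadic_iff:
  "monadic X Y L R \<eta> \<epsilon> \<longleftrightarrow>
    (\<forall>y \<in> Obj Y. effective_arrow X Y L y (FO R y) (\<epsilon> y)) \<and>
    (\<forall>x \<in> Obj X. \<forall>\<theta>. descent_datum X Y L x \<theta> \<longrightarrow> descent_realized X Y L x \<theta>)"
proof
  assume "monadic X Y L R \<eta> \<epsilon>"
  then have eq: "is_equivalence Y EM K" unfolding monadic_def by blast
  have "fully_faithful Y EM K" "essentially_surjective Y EM K"
    using equivalence_imp_fully_faithful[OF Y.category_axioms em_category eq]
      equivalence_imp_essentially_surjective[OF eq] by auto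
  then show "(\<forall>y \<in> Obj Y. effective_arrow X Y L y (FO R y) (\<epsilon> y)) \<and>
    (\<forall>x \<in> Obj X. \<forall>\<theta>. descent_datum X Y L x \<theta> \<longrightarrow> descent_realized X Y L x \<theta>)"
    using comparison_fully_faithful_imp_effective comparison_essentially_surjective_imp_realized
    by blast
next
  assume *: "(\<forall>y \<in> Obj Y. effective_arrow X Y L y (FO R y) (\<epsilon> y)) \<and>
    (\<forall>x \<in> Obj X. \<forall>\<theta>. descent_datum X Y L x \<theta> \<longrightarrow> descent_realized X Y L x \<theta>)"
  have "is_equivalence Y EM K"
    using * by (intro equivalence_if_fully_faithful_essentially_surjective Y.category_axioms em_category
      comparison_is_functor effective_imp_comparison_fully_faithful
      realized_imp_comparison_essentially_surjective) blast+
  then show "monadic X Y L R \<eta> \<epsilon>" unfolding monadic_def using adjunction by blast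
qed

end

context functor_between begin

text \<open>The counit is kept as given. The right adjoint on arrows and the unit are the unique solutions of
the equations that naturality of the counit and the first triangle identity impose.\<close>

lemma adjunction_if_universal_arrows:
  assumes u: "\<And>y. y \<in> Obj Y \<Longrightarrow> universal_arrow X Y L y (r y) (e y)"
  shows "\<exists>R \<eta>. adjunction X Y L R \<eta> e \<and> FO R = r"
proof -
  have [simp]: "r y \<in> Obj X" "e y \<in> Hom Y (FO L (r y)) y" if "y \<in> Obj Y" for y
    using universal_arrow_obj universal_arrow_hom u[OF that] by blast+
  have "\<forall>w y g. \<exists>s. w \<in> Obj X \<and> y \<in> Obj Y \<and> g \<in> Hom Y (FO L w) y \<longrightarrow>
      s \<in> Hom X w (r y) \<and> Cmp Y (FO L w) (FO L (r y)) y (e y) (FM L w (r y) s) = g"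
    using universal_arrow_ex u by blast
  then obtain tr where tr [simp]: "\<And>w y g. \<lbrakk>w \<in> Obj X; y \<in> Obj Y; g \<in> Hom Y (FO L w) y\<rbrakk> \<Longrightarrow> tr w y g \<in> Hom X w (r y)"
    and e_tr [simp]: "\<And>w y g. \<lbrakk>w \<in> Obj X; y \<in> Obj Y; g \<in> Hom Y (FO L w) y\<rbrakk> \<Longrightarrow>
      Cmp Y (FO L w) (FO L (r y)) y (e y) (FM L w (r y) (tr w y g)) = g"
    by metis
  define R where "R = \<lparr>FO = r, FM = (\<lambda>y v k. tr (r y) v (Cmp Y (FO L (r y)) y v k (e y)))\<rparr>"
  define \<eta> where "\<eta> x = tr x (FO L x) (Ide Y (FO L x))" for x
  have e_cmp_tr [simp]: "Cmp Y (FO L v) (FO L (r y)) y (e y) (Cmp Y (FO L v) (FO L w) (FO L (r y)) (FM L w (r y) (tr w y g)) l) =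
      Cmp Y (FO L v) (FO L w) y g l"
    if "v \<in> Obj X" "w \<in> Obj X" "y \<in> Obj Y" "g \<in> Hom Y (FO L w) y" "l \<in> Hom Y (FO L v) (FO L w)"
    for v w y g l
    using that by (simp add: Y.cmp_assoc)
  have e_cmp [simp]: "Cmp Y v (FO L (r y)) u (Cmp Y (FO L (r y)) y u k (e y)) l =
      Cmp Y v y u k (Cmp Y v (FO L (r y)) y (e y) l)"
    if "v \<in> Obj Y" "u \<in> Obj Y" "y \<in> Obj Y" "k \<in> Hom Y y u" "l \<in> Hom Y v (FO L (r y))" for v u y k l
    using that by (simp add: Y.cmp_assoc)
  note inj = universal_arrow_inj[OF u]
  have fR: "is_functor Y X R"
    unfolding is_functor_def
  proof (intro conjI ballI)
    fix y assume [simp]: "y \<in> Obj Y"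
    show "FM R y y (Ide Y y) = Ide X (FO R y)"
      by (rule inj[where w = "r y" and y = y]) (simp_all add: R_def)
  next
    fix y v u k l assume [simp]: "y \<in> Obj Y" "v \<in> Obj Y" "u \<in> Obj Y" "k \<in> Hom Y y v" "l \<in> Hom Y v u"
    show "FM R y u (Cmp Y y v u l k) = Cmp X (FO R y) (FO R v) (FO R u) (FM R v u l) (FM R y v k)"
      by (rule inj[where w = "r y" and y = u]) (simp_all add: R_def Y.cmp_assoc[symmetric])
  qed (simp_all add: R_def)
  have "nat_trans X X fident (fcompose R L) \<eta>"
    unfolding nat_trans_def fident_def fcompose_def fctr.simps
  proof (intro conjI ballI)
    fix x w s assume [simp]: "x \<in> Obj X" "w \<in> Obj X" "s \<in> Hom X x w"
    show "Cmp X x w (FO R (FO L w)) (\<eta> w) s = Cmp X x (FO R (FO L x)) (FO R (FO L w))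
        (FM R (FO L x) (FO L w) (FM L x w s)) (\<eta> x)"
      by (rule inj[where w = x and y = "FO L w"]) (simp_all add: R_def \<eta>_def)
  qed (simp_all add: R_def \<eta>_def)
  moreover have "nat_trans Y Y (fcompose L R) fident e"
    unfolding nat_trans_def fident_def fcompose_def fctr.simps by (simp add: R_def)
  moreover have "Cmp X (r y) (r (FO L (r y))) (r y) (FM R (FO L (r y)) y (e y)) (\<eta> (r y)) = Ide X (r y)"
    if [simp]: "y \<in> Obj Y" for y
    by (rule inj[where w = "r y" and y = y]) (simp_all add: R_def \<eta>_def)
  ultimately have "adjunction X Y L R \<eta> e"
    unfolding adjunction_def using fR is_functor by (simp add: R_def \<eta>_def)
  then show ?thesis by (intro exI[of _ R] exI[of _ \<eta>]) (simp add: R_def)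
qed

text \<open>The existence of a monadic right adjoint has become a condition on \<open>L\<close> that speaks of no right
adjoint, monad or algebra, and so can be compared along functors commuting strictly with \<open>L\<close>.\<close>

lemma monadic_iff_descends: "(\<exists>R \<eta> \<epsilon>. monadic X Y L R \<eta> \<epsilon>) \<longleftrightarrow> descends X Y L"
proof
  assume "\<exists>R \<eta> \<epsilon>. monadic X Y L R \<eta> \<epsilon>"
  then obtain R \<eta> \<epsilon> where m: "monadic X Y L R \<eta> \<epsilon>" by blast
  then interpret adjoint_pair X Y L R \<eta> \<epsilon>
    by unfold_locales (simp add: monadic_def)
  show "descends X Y L"
    using m counit_universal unfolding monadic_iff descends_def by blast
next
  assume d: "descends X Y L"
  then obtain r e where u: "\<And>y. y \<in> Obj Y \<Longrightarrow> universal_arrow X Y L y (r y) (e y)"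
    and eff: "\<And>y. y \<in> Obj Y \<Longrightarrow> effective_arrow X Y L y (r y) (e y)"
    unfolding descends_def by metis
  obtain R \<eta> where "adjunction X Y L R \<eta> e" and R: "FO R = r"
    using adjunction_if_universal_arrows u by blast
  then interpret adjoint_pair X Y L R \<eta> e by unfold_locales
  have "monadic X Y L R \<eta> e"
    unfolding monadic_iff R using d eff unfolding descends_def by blast
  then show "\<exists>R \<eta> \<epsilon>. monadic X Y L R \<eta> \<epsilon>" by blast
qed

end

section \<open>Discrete objects and the transfer of descent\<close>

text \<open>The terminology is that of topological spaces: a discrete space is one out of which every map of
underlying sets is continuous. Equivalently, \<open>x\<close> with the identity of \<open>U x\<close> is a universal arrow from
\<open>U x\<close> to the functor \<open>U\<close>, so a functor with a discrete object over each object of its target has a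
fully faithful left adjoint.\<close>

definition discrete_object ::
  "('o, 'm) cat \<Rightarrow> ('p, 'n) cat \<Rightarrow> ('o, 'm, 'p, 'n) fctr \<Rightarrow> 'o \<Rightarrow> bool" where
  "discrete_object C D U x \<longleftrightarrow> x \<in> Obj C \<and> (\<forall>r \<in> Obj C. \<forall>g \<in> Hom D (FO U x) (FO U r).
     \<exists>!f. f \<in> Hom C x r \<and> FM U x r f = g)"

context functor_between
begin

lemma discrete_object_lift:
  assumes "discrete_object X Y L x" "r \<in> Obj X" "g \<in> Hom Y (FO L x) (FO L r)"
  obtains f where "f \<in> Hom X x r" "FM L x r f = g"
  using assms unfolding discrete_object_def by blast

lemma discrete_object_eqI:
  assumes "discrete_object X Y L x" "FM L x r f = FM L x r g"
    and "r \<in> Obj X" "f \<in> Hom X x r" "g \<in> Hom X x r"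
  shows "f = g"
proof -
  have "x \<in> Obj X" using assms unfolding discrete_object_def by blast
  then have "FM L x r g \<in> Hom Y (FO L x) (FO L r)" using assms by simp
  then have "\<exists>!f. f \<in> Hom X x r \<and> FM L x r f = FM L x r g"
    using assms unfolding discrete_object_def by blast
  then show ?thesis using assms by blast
qed

end

text \<open>A commutative square of functors, with \<open>L\<close> on top and \<open>L'\<close> at the bottom, in which enough objects of
the top row are discrete over the bottom row. By the sieve condition, an object \<open>w\<close>
with an arrow from \<open>L w\<close> to an object of \<open>DY\<close> belongs to \<open>DX\<close>. The sets \<open>DX\<close> and
\<open>DY\<close> may consist of only some of the discrete objects; in the slices considered below they are the arrows
whose domain is discrete, for which compatibility with \<open>L\<close> is immediate.\<close>

locale discrete_square =
  top: functor_between X Y L + bottom: functor_between X' Y' L' +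
  left: functor_between X X' U + right: functor_between Y Y' V
  for X :: "('o, 'm) cat" and Y :: "('p, 'n) cat" and L :: "('o, 'm, 'p, 'n) fctr"
    and X' :: "('a, 'b) cat" and Y' :: "('c, 'd) cat" and L' :: "('a, 'b, 'c, 'd) fctr"
    and U :: "('o, 'm, 'a, 'b) fctr" and V :: "('p, 'n, 'c, 'd) fctr" +
  fixes DX :: "'o set" and DY :: "'p set"
  assumes square_obj: "x \<in> Obj X \<Longrightarrow> FO V (FO L x) = FO L' (FO U x)"
    and square_hom: "\<lbrakk>x \<in> Obj X; w \<in> Obj X; s \<in> Hom X x w\<rbrakk> \<Longrightarrow>
      FM V (FO L x) (FO L w) (FM L x w s) = FM L' (FO U x) (FO U w) (FM U x w s)"
    and discrete_left: "x \<in> DX \<Longrightarrow> discrete_object X X' U x"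
    and discrete_right: "y \<in> DY \<Longrightarrow> discrete_object Y Y' V y"
    and discrete_iff: "x \<in> Obj X \<Longrightarrow> FO L x \<in> DY \<longleftrightarrow> x \<in> DX"
    and discrete_sieve: "\<lbrakk>y \<in> Obj Y; v \<in> DY; f \<in> Hom Y y v\<rbrakk> \<Longrightarrow> y \<in> DY"
    and discrete_cover_left: "x' \<in> Obj X' \<Longrightarrow> \<exists>x \<in> DX. FO U x = x'"
    and discrete_cover_right: "y' \<in> Obj Y' \<Longrightarrow> \<exists>y \<in> DY. FO V y = y'"
begin

lemmas square [simp] = square_obj square_hom

lemma discrete_obj [simp]: "x \<in> DX \<Longrightarrow> x \<in> Obj X" "y \<in> DY \<Longrightarrow> y \<in> Obj Y"
  using discrete_left discrete_right unfolding discrete_object_def by blast+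

lemma push_discrete [simp]: "x \<in> DX \<Longrightarrow> FO L x \<in> DY"
  by (simp add: discrete_iff)

lemma
  shows lift_left: "\<lbrakk>x \<in> DX; r \<in> Obj X; g \<in> Hom X' (FO U x) (FO U r)\<rbrakk> \<Longrightarrow>
      \<exists>f. f \<in> Hom X x r \<and> FM U x r f = g"
    and lift_right: "\<lbrakk>y \<in> DY; v \<in> Obj Y; k \<in> Hom Y' (FO V y) (FO V v)\<rbrakk> \<Longrightarrow>
      \<exists>f. f \<in> Hom Y y v \<and> FM V y v f = k"
  using left.discrete_object_lift[OF discrete_left] right.discrete_object_lift[OF discrete_right]
  by metis+

lemmas left_eqI = left.discrete_object_eqI[OF discrete_left, rotated]
lemmas right_eqI = right.discrete_object_eqI[OF discrete_right, rotated]

text \<open>To test universality of the image against an object of \<open>X'\<close>, replace that object by a discrete one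
above it. The target \<open>y\<close> can be arbitrary because only arrows out of discrete objects are lifted.\<close>

lemma universal_arrow_image:
  assumes u: "universal_arrow X Y L y r e" and y [simp]: "y \<in> Obj Y"
  shows "universal_arrow X' Y' L' (FO V y) (FO U r) (FM V (FO L r) y e)"
  unfolding universal_arrow_def
proof (intro conjI ballI)
  have r [simp]: "r \<in> Obj X" and e [simp]: "e \<in> Hom Y (FO L r) y"
    using top.universal_arrow_obj[OF u] top.universal_arrow_hom[OF u] .
  show "FO U r \<in> Obj X'" by simp
  have "FM V (FO L r) y e \<in> Hom Y' (FO V (FO L r)) (FO V y)" by (simp del: square)
  then show [simp]: "FM V (FO L r) y e \<in> Hom Y' (FO L' (FO U r)) (FO V y)" by simp
  fix w' g' assume "w' \<in> Obj X'" and g': "g' \<in> Hom Y' (FO L' w') (FO V y)"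
  then obtain w where w [simp]: "w \<in> DX" and w': "w' = FO U w"
    using discrete_cover_left by blast
  obtain g where g [simp]: "g \<in> Hom Y (FO L w) y" and Vg: "FM V (FO L w) y g = g'"
    using lift_right[of "FO L w" y g'] g' w' by auto
  obtain s where s [simp]: "s \<in> Hom X w r" and es: "Cmp Y (FO L w) (FO L r) y e (FM L w r s) = g"
    using top.universal_arrow_ex[OF u _ g] by auto
  have image: "FM V (FO L w) y (Cmp Y (FO L w) (FO L r) y e (FM L w r t)) =
      Cmp Y' (FO L' w') (FO L' (FO U r)) (FO V y) (FM V (FO L r) y e) (FM L' w' (FO U r) (FM U w r t))"
    if "t \<in> Hom X w r" for t
    using that by (simp add: w')
  show "\<exists>!s'. s' \<in> Hom X' w' (FO U r) \<and>
      Cmp Y' (FO L' w') (FO L' (FO U r)) (FO V y) (FM V (FO L r) y e) (FM L' w' (FO U r) s') = g'"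
  proof (intro ex1I conjI)
    show "FM U w r s \<in> Hom X' w' (FO U r)" by (simp add: w')
    show "Cmp Y' (FO L' w') (FO L' (FO U r)) (FO V y) (FM V (FO L r) y e)
        (FM L' w' (FO U r) (FM U w r s)) = g'"
      using image[OF s] es Vg by simp
    fix t' assume t': "t' \<in> Hom X' w' (FO U r) \<and>
      Cmp Y' (FO L' w') (FO L' (FO U r)) (FO V y) (FM V (FO L r) y e) (FM L' w' (FO U r) t') = g'"
    then obtain t where t [simp]: "t \<in> Hom X w r" and Ut: "FM U w r t = t'"
      using lift_left[of w r t'] w' by auto
    have "FM V (FO L w) y (Cmp Y (FO L w) (FO L r) y e (FM L w r t)) = FM V (FO L w) y g"
      using image[OF t] t' Ut Vg by simp
    then have "Cmp Y (FO L w) (FO L r) y e (FM L w r t) = Cmp Y (FO L w) (FO L r) y e (FM L w r s)"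
      unfolding es by (rule right_eqI) simp_all
    then have "t = s" by (rule top.universal_arrow_inj[OF u]) simp_all
    then show "t' = FM U w r s" using Ut by simp
  qed
qed

text \<open>Here \<open>y\<close> is discrete since the factorizations to be compared are arrows out of \<open>y\<close>. Every \<open>w\<close> with an arrow
\<open>L w \<rightarrow> L r\<close> has a discrete image under \<open>L\<close>, so identities between arrows out of \<open>L w\<close> may be checked
in \<open>Y'\<close>.\<close>

lemma effective_arrow_image:
  assumes eff: "effective_arrow X Y L y r e" and y [simp]: "y \<in> DY"
    and r [simp]: "r \<in> DX" and e [simp]: "e \<in> Hom Y (FO L r) y"
  shows "effective_arrow X' Y' L' (FO V y) (FO U r) (FM V (FO L r) y e)"
  unfolding effective_arrow_def
proof (intro ballI impI)
  have "FM V (FO L r) y e \<in> Hom Y' (FO V (FO L r)) (FO V y)" by (simp del: square)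
  then have Ve [simp]: "FM V (FO L r) y e \<in> Hom Y' (FO L' (FO U r)) (FO V y)" by simp
  fix v' \<phi>' assume "v' \<in> Obj Y'" and \<phi>': "\<phi>' \<in> Hom Y' (FO L' (FO U r)) v'"
    and fork: "\<forall>w \<in> Obj X'. \<forall>n \<in> Hom Y' (FO L' w) (FO L' (FO U r)). \<forall>s \<in> Hom X' w (FO U r).
      Cmp Y' (FO L' w) (FO L' (FO U r)) (FO V y) (FM V (FO L r) y e) n =
      Cmp Y' (FO L' w) (FO L' (FO U r)) (FO V y) (FM V (FO L r) y e) (FM L' w (FO U r) s) \<longrightarrow>
      Cmp Y' (FO L' w) (FO L' (FO U r)) v' \<phi>' n =
      Cmp Y' (FO L' w) (FO L' (FO U r)) v' \<phi>' (FM L' w (FO U r) s)"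
  then obtain v where v [simp]: "v \<in> DY" and v': "v' = FO V v" using discrete_cover_right by blast
  obtain \<phi> where \<phi> [simp]: "\<phi> \<in> Hom Y (FO L r) v" and V\<phi>: "FM V (FO L r) v \<phi> = \<phi>'"
    using lift_right[of "FO L r" v \<phi>'] \<phi>' v' by auto
  have "Cmp Y (FO L w) (FO L r) v \<phi> n = Cmp Y (FO L w) (FO L r) v \<phi> (FM L w r s)"
    if [simp]: "w \<in> Obj X" "n \<in> Hom Y (FO L w) (FO L r)" "s \<in> Hom X w r"
      and eq: "Cmp Y (FO L w) (FO L r) y e n = Cmp Y (FO L w) (FO L r) y e (FM L w r s)" for w n s
  proof -
    have Lw [simp]: "FO L w \<in> DY"
      by (rule discrete_sieve[of _ "FO L r" n]) simp_all
    have Vn [simp]: "FM V (FO L w) (FO L r) n \<in> Hom Y' (FO L' (FO U w)) (FO L' (FO U r))"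
      using functor_hom[OF right.is_functor, of "FO L w" "FO L r" n] by simp
    have "FM V (FO L w) v (Cmp Y (FO L w) (FO L r) v \<phi> n) =
        FM V (FO L w) v (Cmp Y (FO L w) (FO L r) v \<phi> (FM L w r s))"
      using fork[rule_format, of "FO U w" "FM V (FO L w) (FO L r) n" "FM U w r s"]
        arg_cong[OF eq, of "FM V (FO L w) y"]
      by (simp add: V\<phi> v')
    then show ?thesis by (rule right_eqI) simp_all
  qed
  then obtain k where k [simp]: "k \<in> Hom Y y v" and ke: "Cmp Y (FO L r) y v k e = \<phi>"
    and k_unique: "\<And>l. \<lbrakk>l \<in> Hom Y y v; Cmp Y (FO L r) y v l e = \<phi>\<rbrakk> \<Longrightarrow> l = k"
    using eff discrete_obj(2)[OF v] \<phi> unfolding effective_arrow_def by metis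
  show "\<exists>!k'. k' \<in> Hom Y' (FO V y) v' \<and>
      Cmp Y' (FO L' (FO U r)) (FO V y) v' k' (FM V (FO L r) y e) = \<phi>'"
  proof (intro ex1I conjI)
    show "FM V y v k \<in> Hom Y' (FO V y) v'" by (simp add: v')
    show "Cmp Y' (FO L' (FO U r)) (FO V y) v' (FM V y v k) (FM V (FO L r) y e) = \<phi>'"
      using arg_cong[OF ke, of "FM V (FO L r) v"] by (simp add: V\<phi> v')
    fix l' assume l': "l' \<in> Hom Y' (FO V y) v' \<and>
      Cmp Y' (FO L' (FO U r)) (FO V y) v' l' (FM V (FO L r) y e) = \<phi>'"
    then obtain l where l [simp]: "l \<in> Hom Y y v" and Vl: "FM V y v l = l'"
      using lift_right[of y v l'] v' by auto
    have "FM V (FO L r) v (Cmp Y (FO L r) y v l e) = FM V (FO L r) v \<phi>"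
      using l' by (simp add: Vl V\<phi> v')
    then have "Cmp Y (FO L r) y v l e = \<phi>" by (rule right_eqI) simp_all
    then show "l' = FM V y v k" using k_unique[OF l] Vl by simp
  qed
qed

text \<open>A descent datum \<open>\<theta>'\<close> on \<open>U x\<close> lifts uniquely to one on \<open>x\<close>: each \<open>w\<close> with an arrow \<open>L w \<rightarrow> L x\<close> is discrete,
so that \<open>\<theta>' (U w) (V n)\<close> lifts to an arrow \<open>w \<rightarrow> x\<close>, and the laws are identities between arrows out of
discrete objects. The image of an arrow realizing the lifted datum realizes \<open>\<theta>'\<close>.\<close>

lemma descent_realized_image:
  assumes real: "\<And>\<theta>. descent_datum X Y L x \<theta> \<Longrightarrow> descent_realized X Y L x \<theta>"
    and x [simp]: "x \<in> DX" and datum: "descent_datum X' Y' L' (FO U x) \<theta>'"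
  shows "descent_realized X' Y' L' (FO U x) \<theta>'"
proof -
  have \<theta>'_in: "\<theta>' w n \<in> Hom X' w (FO U x)"
    if "w \<in> Obj X'" "n \<in> Hom Y' (FO L' w) (FO L' (FO U x))" for w n
    using datum that unfolding descent_datum_def by blast
  have \<theta>'_L: "\<theta>' w (FM L' w (FO U x) s) = s" if "w \<in> Obj X'" "s \<in> Hom X' w (FO U x)" for w s
    using datum that unfolding descent_datum_def by blast
  have \<theta>'_cmp: "\<theta>' v (Cmp Y' (FO L' v) (FO L' w) (FO L' (FO U x)) n l) =
      \<theta>' v (Cmp Y' (FO L' v) (FO L' w) (FO L' (FO U x)) (FM L' w (FO U x) (\<theta>' w n)) l)"
    if "v \<in> Obj X'" "w \<in> Obj X'" "l \<in> Hom Y' (FO L' v) (FO L' w)"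
      "n \<in> Hom Y' (FO L' w) (FO L' (FO U x))" for v w l n
    using datum that unfolding descent_datum_def by blast
  have w_discrete: "w \<in> DX" if "w \<in> Obj X" "n \<in> Hom Y (FO L w) (FO L x)" for w n
    using discrete_sieve[of "FO L w" "FO L x" n] that by (simp add: discrete_iff)
  have Vn [simp]: "FM V (FO L v) (FO L w) n \<in> Hom Y' (FO L' (FO U v)) (FO L' (FO U w))"
    if "v \<in> Obj X" "w \<in> Obj X" "n \<in> Hom Y (FO L v) (FO L w)" for v w n
    using functor_hom[OF right.is_functor, of "FO L v" "FO L w" n] that by simp
  define \<theta> where "\<theta> w n = (SOME s. s \<in> Hom X w x \<and>
    FM U w x s = \<theta>' (FO U w) (FM V (FO L w) (FO L x) n))" for w n
  have \<theta>: "\<theta> w n \<in> Hom X w x \<and> FM U w x (\<theta> w n) = \<theta>' (FO U w) (FM V (FO L w) (FO L x) n)"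
    if "w \<in> Obj X" "n \<in> Hom Y (FO L w) (FO L x)" for w n
    unfolding \<theta>_def by (rule someI_ex, rule lift_left) (use that w_discrete in \<open>auto intro!: \<theta>'_in\<close>)
  note [simp] = \<theta>[THEN conjunct1] \<theta>[THEN conjunct2]
  have "descent_datum X Y L x \<theta>"
    unfolding descent_datum_def
  proof (intro conjI ballI)
    fix w s assume [simp]: "w \<in> Obj X" "s \<in> Hom X w x"
    then have w [simp]: "w \<in> DX" by (intro w_discrete[of w "FM L w x s"]) simp_all
    have "FM U w x (\<theta> w (FM L w x s)) = FM U w x s" by (simp add: \<theta>'_L)
    then show "\<theta> w (FM L w x s) = s" by (rule left_eqI) simp_all
  next
    fix v w l n assume [simp]: "v \<in> Obj X" "w \<in> Obj X" "l \<in> Hom Y (FO L v) (FO L w)"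
      and n [simp]: "n \<in> Hom Y (FO L w) (FO L x)"
    have w [simp]: "w \<in> DX" using w_discrete[of w n] by simp
    have v [simp]: "v \<in> DX"
      using w_discrete[of v "Cmp Y (FO L v) (FO L w) (FO L x) n l"] by simp
    have "FM U v x (\<theta> v (Cmp Y (FO L v) (FO L w) (FO L x) n l)) =
        FM U v x (\<theta> v (Cmp Y (FO L v) (FO L w) (FO L x) (FM L w x (\<theta> w n)) l))"
      using \<theta>'_cmp[of "FO U v" "FO U w" "FM V (FO L v) (FO L w) l" "FM V (FO L w) (FO L x) n"]
      by simp
    then show "\<theta> v (Cmp Y (FO L v) (FO L w) (FO L x) n l) =
        \<theta> v (Cmp Y (FO L v) (FO L w) (FO L x) (FM L w x (\<theta> w n)) l)"
      by (rule left_eqI) simp_all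
  qed simp
  then obtain y q where y [simp]: "y \<in> Obj Y" and u: "universal_arrow X Y L y x q"
    and q\<theta>: "\<And>w n. \<lbrakk>w \<in> Obj X; n \<in> Hom Y (FO L w) (FO L x)\<rbrakk> \<Longrightarrow>
        Cmp Y (FO L w) (FO L x) y q (FM L w x (\<theta> w n)) = Cmp Y (FO L w) (FO L x) y q n"
    using real unfolding descent_realized_def by blast
  have q [simp]: "q \<in> Hom Y (FO L x) y" using top.universal_arrow_hom[OF u] .
  have "Cmp Y' (FO L' w') (FO L' (FO U x)) (FO V y) (FM V (FO L x) y q)
        (FM L' w' (FO U x) (\<theta>' w' n')) =
      Cmp Y' (FO L' w') (FO L' (FO U x)) (FO V y) (FM V (FO L x) y q) n'"
    if "w' \<in> Obj X'" and n': "n' \<in> Hom Y' (FO L' w') (FO L' (FO U x))" for w' n'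
  proof -
    obtain w where w [simp]: "w \<in> DX" and w': "w' = FO U w"
      using discrete_cover_left \<open>w' \<in> Obj X'\<close> by blast
    obtain n where n [simp]: "n \<in> Hom Y (FO L w) (FO L x)" "FM V (FO L w) (FO L x) n = n'"
      using lift_right[of "FO L w" "FO L x" n'] n' w' by auto
    show ?thesis
      using arg_cong[OF q\<theta>[of w n], of "FM V (FO L w) y"] by (simp add: w')
  qed
  then show ?thesis
    unfolding descent_realized_def using universal_arrow_image[OF u y]
      functor_obj[OF right.is_functor y] by blast
qed

lemma descends_image:
  assumes "descends X Y L"
  shows "descends X' Y' L'"
  unfolding descends_def
proof (intro conjI ballI allI impI)
  fix y' assume "y' \<in> Obj Y'"
  then obtain y where y: "y \<in> DY" and y': "y' = FO V y" using discrete_cover_right by blast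
  obtain r e where u: "universal_arrow X Y L y r e" and eff: "effective_arrow X Y L y r e"
    using assms y unfolding descends_def by (meson discrete_obj(2))
  note r = top.universal_arrow_obj[OF u] and e = top.universal_arrow_hom[OF u]
  have "r \<in> DX" using discrete_sieve[OF _ y e] r by (simp add: discrete_iff)
  then show "\<exists>r e. universal_arrow X' Y' L' y' r e \<and> effective_arrow X' Y' L' y' r e"
    using universal_arrow_image[OF u] effective_arrow_image[OF eff y _ e] y y' by auto
next
  fix x' \<theta>' assume "x' \<in> Obj X'" and datum: "descent_datum X' Y' L' x' \<theta>'"
  then obtain x where x: "x \<in> DX" and x': "x' = FO U x" using discrete_cover_left by blast
  show "descent_realized X' Y' L' x' \<theta>'"
    unfolding x'
  proof (rule descent_realized_image[OF _ x])
    show "descent_realized X Y L x \<theta>" if "descent_datum X Y L x \<theta>" for \<theta>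
      using assms that discrete_obj(1)[OF x] unfolding descends_def by blast
    show "descent_datum X' Y' L' (FO U x) \<theta>'" using datum x' by simp
  qed
qed

end

section \<open>Effective descent along functors with enough discrete objects\<close>

lemma slice_simps:
  "(x, f) \<in> Obj (slice C a) \<longleftrightarrow> x \<in> Obj C \<and> f \<in> Hom C x a"
  "h \<in> Hom (slice C a) (x, f) (y, g) \<longleftrightarrow> h \<in> Hom C x y \<and> Cmp C x y a g h = f"
  "Ide (slice C a) (x, f) = Ide C x"
  "Cmp (slice C a) (x, f) (y, g) (w, k) m l = Cmp C x y w m l"
  by (simp_all add: slice_def)

lemma (in category) slice_category: "a \<in> Obj C \<Longrightarrow> category (slice C a)"
  by unfold_locales
    (auto simp: slice_simps ide_in cmp_in cmp_ide_left cmp_ide_right cmp_assoc)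

lemma slice_push_simps:
  "FO (slice_push C a b p) (x, f) = (x, Cmp C x a b p f)"
  "FM (slice_push C a b p) s t h = h"
  by (simp_all add: slice_push_def)

lemma (in category) slice_push_functor:
  assumes "a \<in> Obj C" "b \<in> Obj C" "p \<in> Hom C a b"
  shows "is_functor (slice C a) (slice C b) (slice_push C a b p)"
  using assms unfolding is_functor_def
  by (auto simp: slice_simps slice_push_simps cmp_in cmp_assoc[symmetric])

lemma (in category) effective_descent_iff:
  "effective_descent C a b p \<longleftrightarrow> a \<in> Obj C \<and> b \<in> Obj C \<and> p \<in> Hom C a b \<and>
     has_pullbacks_along C a b p \<and> descends (slice C a) (slice C b) (slice_push C a b p)"
proof (cases "a \<in> Obj C \<and> b \<in> Obj C \<and> p \<in> Hom C a b")
  case True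
  then interpret functor_between "slice C a" "slice C b" "slice_push C a b p"
    by (intro functor_between.intro functor_between_axioms.intro slice_category slice_push_functor)
      auto
  show ?thesis unfolding effective_descent_def monadic_iff_descends by (rule refl)
qed (auto simp: effective_descent_def)

definition slice_functor ::
  "('o, 'm, 'p, 'n) fctr \<Rightarrow> 'o \<Rightarrow> ('o \<times> 'm, 'm, 'p \<times> 'n, 'n) fctr" where
  "slice_functor F a = \<lparr>FO = (\<lambda>(x, f). (FO F x, FM F x a f)),
     FM = (\<lambda>(x, f) (y, g) h. FM F x y h)\<rparr>"

lemma slice_functor_simps:
  "FO (slice_functor F a) (x, f) = (FO F x, FM F x a f)"
  "FM (slice_functor F a) (x, f) (y, g) h = FM F x y h"
  by (simp_all add: slice_functor_def)

context functor_between
begin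

lemma slice_functor_is_functor:
  assumes "a \<in> Obj X"
  shows "is_functor (slice X a) (slice Y (FO L a)) (slice_functor L a)"
  using assms unfolding is_functor_def
  by (auto simp: slice_simps slice_functor_simps simp flip: functor_cmp[OF is_functor])

text \<open>The lift of an arrow over \<open>L a\<close> is an arrow over \<open>a\<close>, because arrows from \<open>x\<close> to \<open>a\<close> are determined by their
images under \<open>L\<close>.\<close>

lemma slice_discrete_object:
  assumes a: "a \<in> Obj X" and x: "discrete_object X Y L x" and f: "f \<in> Hom X x a"
  shows "discrete_object (slice X a) (slice Y (FO L a)) (slice_functor L a) (x, f)"
  unfolding discrete_object_def
proof (intro conjI ballI)
  have [simp]: "x \<in> Obj X" using x unfolding discrete_object_def by blast
  note [simp] = a f
  show "(x, f) \<in> Obj (slice X a)" by (simp add: slice_simps)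
  fix s g assume "s \<in> Obj (slice X a)"
    and g: "g \<in> Hom (slice Y (FO L a)) (FO (slice_functor L a) (x, f)) (FO (slice_functor L a) s)"
  moreover obtain y k where s: "s = (y, k)" by fastforce
  ultimately have [simp]: "y \<in> Obj X" "k \<in> Hom X y a" by (simp_all add: slice_simps)
  have g': "g \<in> Hom Y (FO L x) (FO L y)" and
    kg: "Cmp Y (FO L x) (FO L y) (FO L a) (FM L y a k) g = FM L x a f"
    using g by (simp_all add: s slice_functor_simps slice_simps)
  obtain h where h [simp]: "h \<in> Hom X x y" and Lh: "FM L x y h = g"
    using discrete_object_lift[OF x _ g'] by auto
  have "FM L x a (Cmp X x y a k h) = FM L x a f" by (simp add: Lh kg)
  then have kh: "Cmp X x y a k h = f" by (rule discrete_object_eqI[OF x]) simp_all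
  show "\<exists>!h. h \<in> Hom (slice X a) (x, f) s \<and> FM (slice_functor L a) (x, f) s h = g"
    unfolding s slice_functor_simps slice_simps
    using discrete_object_eqI[OF x] h kh Lh by (intro ex1I[of _ h]) auto
qed

end

text \<open>These two conditions are all that is used of the projection in the theorem. They provide \<open>U\<close>
with a fully faithful left adjoint whose image, up to isomorphism, is a sieve.\<close>

locale enough_discrete = functor_between E A U
  for E :: "('o, 'm) cat" and A :: "('p, 'n) cat" and U :: "('o, 'm, 'p, 'n) fctr" +
  assumes discrete_cover: "c \<in> Obj A \<Longrightarrow> \<exists>q. discrete_object E A U q \<and> FO U q = c"
    and discrete_sieve: "\<lbrakk>discrete_object E A U d; e \<in> Obj E; f \<in> Hom E e d\<rbrakk> \<Longrightarrow>
      discrete_object E A U e"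
begin

lemma discrete_object_obj: "discrete_object E A U q \<Longrightarrow> q \<in> Obj E"
  unfolding discrete_object_def by blast

lemma slice_discrete_cover:
  assumes "a \<in> Obj E" "x' \<in> Obj (slice A (FO U a))"
  shows "\<exists>x \<in> {s \<in> Obj (slice E a). discrete_object E A U (fst s)}. FO (slice_functor U a) x = x'"
proof -
  obtain c g where x': "x' = (c, g)" by fastforce
  then have c: "c \<in> Obj A" and g: "g \<in> Hom A c (FO U a)" using assms by (simp_all add: slice_simps)
  obtain q where q: "discrete_object E A U q" "FO U q = c" using discrete_cover[OF c] by blast
  obtain h where h: "h \<in> Hom E q a" "FM U q a h = g"
    using discrete_object_lift[OF q(1) assms(1), of g] g q(2) by auto
  show ?thesis
    using q h x' discrete_object_obj
    by (intro bexI[of _ "(q, h)"]) (auto simp: slice_simps slice_functor_simps)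
qed

lemma descends_slice_image:
  assumes [simp]: "a \<in> Obj E" "b \<in> Obj E" "p \<in> Hom E a b"
    and "descends (slice E a) (slice E b) (slice_push E a b p)"
  shows "descends (slice A (FO U a)) (slice A (FO U b))
    (slice_push A (FO U a) (FO U b) (FM U a b p))"
proof -
  interpret discrete_square "slice E a" "slice E b" "slice_push E a b p"
    "slice A (FO U a)" "slice A (FO U b)" "slice_push A (FO U a) (FO U b) (FM U a b p)"
    "slice_functor U a" "slice_functor U b"
    "{s \<in> Obj (slice E a). discrete_object E A U (fst s)}"
    "{s \<in> Obj (slice E b). discrete_object E A U (fst s)}"
  proof (intro discrete_square.intro functor_between.intro functor_between_axioms.intro
      discrete_square_axioms.intro)
    fix y v f assume "y \<in> Obj (slice E b)" "f \<in> Hom (slice E b) y v"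
      and "v \<in> {s \<in> Obj (slice E b). discrete_object E A U (fst s)}"
    then show "y \<in> {s \<in> Obj (slice E b). discrete_object E A U (fst s)}"
      by (cases y; cases v) (auto simp: slice_simps intro: discrete_sieve)
  qed (auto simp: slice_simps slice_push_simps slice_functor_simps
      intro: X.slice_category Y.slice_category X.slice_push_functor Y.slice_push_functor
        slice_functor_is_functor slice_discrete_object slice_discrete_cover[simplified])
  show ?thesis using descends_image assms(4) .
qed

text \<open>A cone in \<open>A\<close> is lifted to a cone in \<open>E\<close> whose vertex is discrete; this is the argument by which right
adjoints preserve limits.\<close>

lemma pullback_image:
  assumes [simp]: "a \<in> Obj E" "b \<in> Obj E" "c \<in> Obj E" "p \<in> Hom E a b" "g \<in> Hom E c b"
    and pb: "is_pullback E a b c p g d u v"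
  shows "is_pullback A (FO U a) (FO U b) (FO U c) (FM U a b p) (FM U c b g)
    (FO U d) (FM U d a u) (FM U d c v)"
  unfolding is_pullback_def
proof (intro conjI ballI impI)
  have d [simp]: "d \<in> Obj E" and u [simp]: "u \<in> Hom E d a" and v [simp]: "v \<in> Hom E d c"
    and comm: "Cmp E d a b p u = Cmp E d c b g v"
    using pb unfolding is_pullback_def by blast+
  show "Cmp A (FO U d) (FO U a) (FO U b) (FM U a b p) (FM U d a u) =
      Cmp A (FO U d) (FO U c) (FO U b) (FM U c b g) (FM U d c v)"
    using arg_cong[OF comm, of "FM U d b"] by simp
  fix e' r' s' assume e': "e' \<in> Obj A" and r': "r' \<in> Hom A e' (FO U a)" and s': "s' \<in> Hom A e' (FO U c)"
    and comm': "Cmp A e' (FO U a) (FO U b) (FM U a b p) r' = Cmp A e' (FO U c) (FO U b) (FM U c b g) s'"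
  obtain e where e: "discrete_object E A U e" and Ue: "FO U e = e'" using discrete_cover[OF e'] by blast
  have [simp]: "e \<in> Obj E" using discrete_object_obj[OF e] .
  obtain r where r [simp]: "r \<in> Hom E e a" and Ur: "FM U e a r = r'"
    using discrete_object_lift[OF e, of a r'] r' Ue by auto
  obtain s where s [simp]: "s \<in> Hom E e c" and Us: "FM U e c s = s'"
    using discrete_object_lift[OF e, of c s'] s' Ue by auto
  have "FM U e b (Cmp E e a b p r) = FM U e b (Cmp E e c b g s)"
    using comm' by (simp add: Ur Us Ue)
  then have "Cmp E e a b p r = Cmp E e c b g s" by (rule discrete_object_eqI[OF e]) simp_all
  then obtain t where t [simp]: "t \<in> Hom E e d" and ut: "Cmp E e d a u t = r" and vt: "Cmp E e d c v t = s"
    and t_unique: "\<And>k. \<lbrakk>k \<in> Hom E e d; Cmp E e d a u k = r; Cmp E e d c v k = s\<rbrakk> \<Longrightarrow> k = t"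
    using pb \<open>e \<in> Obj E\<close> r s unfolding is_pullback_def by metis
  show "\<exists>!t'. t' \<in> Hom A e' (FO U d) \<and> Cmp A e' (FO U d) (FO U a) (FM U d a u) t' = r' \<and>
      Cmp A e' (FO U d) (FO U c) (FM U d c v) t' = s'"
  proof (intro ex1I conjI)
    show "FM U e d t \<in> Hom A e' (FO U d)" unfolding Ue[symmetric] by simp
    show "Cmp A e' (FO U d) (FO U a) (FM U d a u) (FM U e d t) = r'"
      using arg_cong[OF ut, of "FM U e a"] by (simp add: Ur Ue)
    show "Cmp A e' (FO U d) (FO U c) (FM U d c v) (FM U e d t) = s'"
      using arg_cong[OF vt, of "FM U e c"] by (simp add: Us Ue)
    fix k' assume k': "k' \<in> Hom A e' (FO U d) \<and> Cmp A e' (FO U d) (FO U a) (FM U d a u) k' = r' \<and>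
      Cmp A e' (FO U d) (FO U c) (FM U d c v) k' = s'"
    then obtain k where k [simp]: "k \<in> Hom E e d" and Uk: "FM U e d k = k'"
      using discrete_object_lift[OF e, of d k'] Ue by auto
    have "FM U e a (Cmp E e d a u k) = FM U e a r" using k' by (simp add: Uk Ue Ur)
    then have "Cmp E e d a u k = r" by (rule discrete_object_eqI[OF e]) simp_all
    moreover have "FM U e c (Cmp E e d c v k) = FM U e c s" using k' by (simp add: Uk Ue Us)
    then have "Cmp E e d c v k = s" by (rule discrete_object_eqI[OF e]) simp_all
    ultimately show "k' = FM U e d t" using t_unique[OF k] Uk by simp
  qed
qed (use pb in \<open>simp_all add: is_pullback_def\<close>)

text \<open>An arrow into \<open>U b\<close> is the image of an arrow into \<open>b\<close> with discrete domain, and \<open>U\<close> preserves the pullback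
of the latter.\<close>

lemma has_pullbacks_along_image:
  assumes [simp]: "a \<in> Obj E" "b \<in> Obj E" "p \<in> Hom E a b" and pb: "has_pullbacks_along E a b p"
  shows "has_pullbacks_along A (FO U a) (FO U b) (FM U a b p)"
  unfolding has_pullbacks_along_def
proof (intro ballI)
  fix c' g' assume c': "c' \<in> Obj A" and g': "g' \<in> Hom A c' (FO U b)"
  obtain c where c: "discrete_object E A U c" and Uc: "FO U c = c'" using discrete_cover[OF c'] by blast
  have [simp]: "c \<in> Obj E" using discrete_object_obj[OF c] .
  obtain g where g: "g \<in> Hom E c b" "FM U c b g = g'"
    using discrete_object_lift[OF c, of b g'] g' Uc by auto
  obtain d u v where "is_pullback E a b c p g d u v"
    using pb g unfolding has_pullbacks_along_def by (metis \<open>c \<in> Obj E\<close>)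
  then have "is_pullback A (FO U a) (FO U b) (FO U c) (FM U a b p) (FM U c b g)
    (FO U d) (FM U d a u) (FM U d c v)" using g(1) by (intro pullback_image) simp_all
  then show "\<exists>d u v. is_pullback A (FO U a) (FO U b) c' (FM U a b p) g' d u v"
    unfolding Uc g(2) by blast
qed

lemma preserves_effective_descent: "preserves_effective_descent E A U"
  unfolding preserves_effective_descent_def X.effective_descent_iff Y.effective_descent_iff
  using has_pullbacks_along_image descends_slice_image by simp

end

section \<open>The fibration of co-Kleisli categories\<close>

lemma (in category) strict_initial_source:
  assumes z: "is_strict_initial C z" and x [simp]: "x \<in> Obj C" and f: "f \<in> Hom C x z"
  shows "is_initial C x"
  unfolding is_initial_def
proof (intro conjI ballI)
  fix y assume y [simp]: "y \<in> Obj C"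
  have z' [simp]: "z \<in> Obj C" using z unfolding is_strict_initial_def is_initial_def by blast
  obtain i j where [simp]: "i \<in> Hom C x z" "j \<in> Hom C z x" and ji: "Cmp C x z x j i = Ide C x"
    using z f x unfolding is_strict_initial_def isomorphic_def is_iso_def by blast
  obtain k where k [simp]: "k \<in> Hom C z y" and k_unique: "\<And>l. l \<in> Hom C z y \<Longrightarrow> l = k"
    using z y unfolding is_strict_initial_def is_initial_def by blast
  show "\<exists>!g. g \<in> Hom C x y"
  proof (rule ex1I)
    show "Cmp C x z y k i \<in> Hom C x y" by (simp add: cmp_in)
    fix g assume g: "g \<in> Hom C x y"
    then have "Cmp C z x y g j = k" by (intro k_unique) (simp add: cmp_in)
    from this[symmetric] have "Cmp C x z y k i = Cmp C x x y g (Cmp C x z x j i)"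
      using g by (simp add: cmp_assoc)
    then show "g = Cmp C x z y k i" using g by (simp add: ji cmp_ide_right)
  qed
qed simp

context category_with_products
begin

abbreviation E :: "('o \<times> 'o, 'm \<times> 'm) cat" where
  "E \<equiv> grothendieck A (cokleisli_psf A P)"

lemma simple_fibration_simps:
  "(a, x) \<in> Obj E \<longleftrightarrow> a \<in> Obj A \<and> x \<in> Obj A"
  "(f, \<phi>) \<in> Hom E (a, x) (b, y) \<longleftrightarrow> f \<in> Hom A a b \<and> \<phi> \<in> Hom A (Prd P a x) y"
  "Ide E (a, x) = (Ide A a, Snd P a x)"
  by (simp_all add: grothendieck_def cokleisli_psf_def cokleisli_sub_def cokleisli_simps)

text \<open>The comparison cells are identities, and the composite of the vertical parts is
\<open>\<gamma> \<circ> \<langle>f \<circ> \<pi>\<^sub>1, \<phi>\<rangle>\<close>.\<close>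

lemma simple_fibration_cmp:
  assumes "a \<in> Obj A" "x \<in> Obj A" "b \<in> Obj A" "y \<in> Obj A" "c \<in> Obj A" "w \<in> Obj A"
    and "f \<in> Hom A a b" "\<phi> \<in> Hom A (Prd P a x) y" "g \<in> Hom A b c" "\<gamma> \<in> Hom A (Prd P b y) w"
  shows "Cmp E (a, x) (b, y) (c, w) (g, \<gamma>) (f, \<phi>) =
    (Cmp A a b c g f, Cmp A (Prd P a x) (Prd P b y) w \<gamma>
      (pairing A P (Prd P a x) b y (Cmp A (Prd P a x) a b f (Fst P a x)) \<phi>))"
  using assms
  by (simp add: grothendieck_def cokleisli_psf_def cokleisli_sub_def cokleisli_simps
      cokleisli_cmp prod_norm)

lemma simple_fibration_category: "category E"
proof
  fix s assume "s \<in> Obj E"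
  then show "Ide E s \<in> Hom E s s" by (cases s) (simp add: simple_fibration_simps prod_norm)
next
  fix s t f assume "s \<in> Obj E" "t \<in> Obj E" "f \<in> Hom E s t"
  then show "Cmp E s t t (Ide E t) f = f"
    by (cases s; cases t; cases f) (simp add: simple_fibration_simps simple_fibration_cmp prod_norm)
next
  fix s t f assume "s \<in> Obj E" "t \<in> Obj E" "f \<in> Hom E s t"
  then show "Cmp E s s t f (Ide E s) = f"
    by (cases s; cases t; cases f) (simp add: simple_fibration_simps simple_fibration_cmp prod_norm)
next
  fix r s t f g assume "r \<in> Obj E" "s \<in> Obj E" "t \<in> Obj E" "f \<in> Hom E r s" "g \<in> Hom E s t"
  then show "Cmp E r s t g f \<in> Hom E r t"
    by (cases r; cases s; cases t; cases f; cases g)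
      (simp add: simple_fibration_simps simple_fibration_cmp prod_norm)
next
  fix q r s t f g h assume "q \<in> Obj E" "r \<in> Obj E" "s \<in> Obj E" "t \<in> Obj E"
    and "f \<in> Hom E q r" "g \<in> Hom E r s" "h \<in> Hom E s t"
  then show "Cmp E q s t h (Cmp E q r s g f) = Cmp E q r t (Cmp E r s t h g) f"
    by (cases q; cases r; cases s; cases t; cases f; cases g; cases h)
      (simp add: simple_fibration_simps simple_fibration_cmp prod_norm)
qed

lemma simple_fibration_proj_functor: "is_functor E A grothendieck_proj"
  unfolding is_functor_def grothendieck_proj_def
  by (auto simp: simple_fibration_simps simple_fibration_cmp)

text \<open>The arrows \<open>(a, x) \<rightarrow> (b, y)\<close> over \<open>f\<close> are the arrows \<open>a \<times> x \<rightarrow> y\<close>, whatever \<open>f\<close> is.\<close>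

lemma simple_fibration_discrete_iff:
  assumes "a \<in> Obj A" "x \<in> Obj A"
  shows "discrete_object E A grothendieck_proj (a, x) \<longleftrightarrow> is_initial A (Prd P a x)"
proof
  assume d: "discrete_object E A grothendieck_proj (a, x)"
  have "\<exists>!\<phi>. \<phi> \<in> Hom A (Prd P a x) y" if "y \<in> Obj A" for y
  proof -
    have "(a, y) \<in> Obj E" "Ide A a \<in> Hom A (FO grothendieck_proj (a, x)) (FO grothendieck_proj (a, y))"
      using assms that by (simp_all add: simple_fibration_simps grothendieck_proj_def ide_in)
    then have "\<exists>!f. f \<in> Hom E (a, x) (a, y) \<and> FM grothendieck_proj (a, x) (a, y) f = Ide A a"
      using d unfolding discrete_object_def by blast
    then show ?thesis
      using assms that by (auto simp: simple_fibration_simps grothendieck_proj_def ide_in)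
  qed
  then show "is_initial A (Prd P a x)" using assms unfolding is_initial_def by (simp add: prd_obj)
next
  assume initial: "is_initial A (Prd P a x)"
  show "discrete_object E A grothendieck_proj (a, x)"
    unfolding discrete_object_def
  proof (intro conjI ballI)
    fix s f assume s: "s \<in> Obj E" and f: "f \<in> Hom A (FO grothendieck_proj (a, x)) (FO grothendieck_proj s)"
    obtain b y where [simp]: "s = (b, y)" by fastforce
    have "\<exists>!\<phi>. \<phi> \<in> Hom A (Prd P a x) y"
      using initial s unfolding is_initial_def by (simp add: simple_fibration_simps)
    then show "\<exists>!h. h \<in> Hom E (a, x) s \<and> FM grothendieck_proj (a, x) s h = f"
      using f by (auto simp: simple_fibration_simps grothendieck_proj_def)
  qed (use assms in \<open>simp add: simple_fibration_simps\<close>)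
qed

text \<open>The object \<open>(c, z)\<close> over \<open>c\<close> is discrete since \<open>c \<times> z\<close> projects to the strict initial object \<open>z\<close>. An arrow
\<open>(h, \<phi>)\<close> from \<open>(a, v)\<close> to a discrete object \<open>(c, x)\<close> gives \<open>\<langle>h \<circ> \<pi>\<^sub>1, \<phi>\<rangle> : a \<times> v \<rightarrow> c \<times> x\<close> with initial codomain,
so \<open>a \<times> v\<close> maps to \<open>z\<close> and is initial as well.\<close>

lemma simple_fibration_enough_discrete:
  assumes z: "is_strict_initial A z"
  shows "enough_discrete E A grothendieck_proj"
proof (intro enough_discrete.intro functor_between.intro functor_between_axioms.intro
    enough_discrete_axioms.intro simple_fibration_category category_axioms
    simple_fibration_proj_functor)
  have z_obj: "z \<in> Obj A" using z unfolding is_strict_initial_def is_initial_def by blast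
  fix c assume c: "c \<in> Obj A"
  have "is_initial A (Prd P c z)"
    using strict_initial_source[OF z] c z_obj prd_obj snd_in by blast
  then have "discrete_object E A grothendieck_proj (c, z)"
    using simple_fibration_discrete_iff c z_obj by simp
  then show "\<exists>q. discrete_object E A grothendieck_proj q \<and> FO grothendieck_proj q = c"
    by (intro exI[of _ "(c, z)"]) (simp add: grothendieck_proj_def)
next
  have z_obj: "z \<in> Obj A" using z unfolding is_strict_initial_def is_initial_def by blast
  fix d e f assume "discrete_object E A grothendieck_proj d" "e \<in> Obj E" "f \<in> Hom E e d"
  moreover obtain c x a v h \<phi> where [simp]: "d = (c, x)" "e = (a, v)" "f = (h, \<phi>)"
    by (metis surj_pair)
  ultimately have d: "discrete_object E A grothendieck_proj (c, x)"
    and [simp]: "a \<in> Obj A" "v \<in> Obj A" "h \<in> Hom A a c" "\<phi> \<in> Hom A (Prd P a v) x"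
    by (simp_all add: simple_fibration_simps)
  then have [simp]: "c \<in> Obj A" "x \<in> Obj A"
    unfolding discrete_object_def by (simp_all add: simple_fibration_simps)
  then obtain k where k: "k \<in> Hom A (Prd P c x) z"
    using d z_obj simple_fibration_discrete_iff unfolding is_initial_def by blast
  have "Cmp A (Prd P a v) (Prd P c x) z k
      (pairing A P (Prd P a v) c x (Cmp A (Prd P a v) a c h (Fst P a v)) \<phi>) \<in> Hom A (Prd P a v) z"
    using k z_obj by (simp add: prod_simps)
  then have "is_initial A (Prd P a v)" using strict_initial_source[OF z] prd_obj by simp
  then show "discrete_object E A grothendieck_proj e" using simple_fibration_discrete_iff by simp
qed

end

theorem lemma25:
  fixes A :: "('o, 'm) cat" and P :: "('o, 'm) prods" and z :: 'o
  assumes "category A"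
    and "binary_products A P"
    and "is_strict_initial A z"
  shows "preserves_effective_descent
           (grothendieck A (cokleisli_psf A P)) A grothendieck_proj"
proof -
  interpret category_with_products A P
    using assms by (intro category_with_products.intro category_with_products_axioms.intro)
  show ?thesis
    by (rule enough_discrete.preserves_effective_descent[OF simple_fibration_enough_discrete[OF assms(3)]])
qed

end
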